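(* Let $\mathcal X=[\![\mathcal U_1,\mathcal U_2,\dots,\mathcal U_d]\!]\in\mathcal N_{\mathbf r}$ with left-orthogonal cores $\mathcal U_k\in\mathbb C^{r_{k-1}\times n_k\times r_k}$. Then the tangent space $\mathrm T_{\mathcal X}\mathcal N_{\mathbf r}$ of $\mathcal N_{\mathbf r}$ at $\mathcal X$ is exactly the set of all tensors of the form $$[\![\dot{\mathcal U}_1,\mathcal U_2,\mathcal U_3,\dots,\mathcal U_d]\!]+[\![\mathcal U_1,\dot{\mathcal U}_2,\mathcal U_3,\dots,\mathcal U_d]\!]+\cdots+[\![\mathcal U_1,\mathcal U_2,\dots,\mathcal U_{d-1},\dot{\mathcal U}_d]\!]$$ with $\dot{\mathcal U}_k\in\mathbb C^{r_{k-1}\times n_k\times r_k}$ for $k=1,\dots,d$, such that $\mathrm L(\dot{\mathcal U}_k)^\dagger\,\mathrm L(\mathcal U_k)=0$ for $k=1,\dots,d-1$ and $\langle\dot{\mathcal U}_d,\mathcal U_d\rangle=0$.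
   Context: Let $d\ge2$ and $\mathbf r=(r_0,r_1,\dots,r_d)$ be positive integers with $r_0=r_d=1$. For $\mathcal X\in\mathbb C^{n_1\times\cdots\times n_d}$, $\mathbf X_{\langle k\rangle}\in\mathbb C^{(n_1\cdots n_k)\times(n_{k+1}\cdots n_d)}$ is the unfolding with rows indexed by $(i_1,\dots,i_k)$ and columns by $(i_{k+1},\dots,i_d)$, and $\mathrm{rank}_{\mathrm{TT}}(\mathcal X)=(1,\mathrm{rank}\,\mathbf X_{\langle1\rangle},\dots,\mathrm{rank}\,\mathbf X_{\langle d-1\rangle},1)$. The inner product is $\langle\mathcal X,\mathcal Y\rangle=\sum\overline{\mathcal X(i_1,\dots,i_d)}\,\mathcal Y(i_1,\dots,i_d)$, with Frobenius norm $\|\mathcal X\|_{\mathrm F}=\sqrt{\langle\mathcal X,\mathcal X\rangle}$. $[\![\mathcal U_1,\dots,\mathcal U_d]\!]$ is the tensor with entries $\mathbf U_1(i_1)\cdots\mathbf U_d(i_d)$, $\mathbf U_k(i_k)=\mathcal U_k(:,i_k,:)$. The left unfolding $\mathrm L(\mathcal U_k)\in\mathbb C^{(r_{k-1}n_k)\times r_k}$ groups the first two indices of $\mathcal U_k$ into the row index. Cores are left-orthogonal if $\mathrm L(\mathcal U_k)^\dagger\mathrm L(\mathcal U_k)=\mathbf I_{r_k}$ for $k=1,\dots,d-1$ ($\dagger$ is conjugate transpose). $\mathcal M_{\mathbf r}=\{\mathcal X:\mathrm{rank}_{\mathrm{TT}}(\mathcal X)=\mathbf r\}$ is a complex submanifold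 of $\mathbb C^{n_1\times\cdots\times n_d}$; $\mathcal B_1=\{\mathcal X:\|\mathcal X\|_{\mathrm F}=1\}$; $\mathcal N_{\mathbf r}=\mathcal M_{\mathbf r}\cap\mathcal B_1$. The known tangent space of $\mathcal M_{\mathbf r}$ at $\mathcal X=[\![\mathcal U_1,\dots,\mathcal U_d]\!]$ is the set of all sums $\sum_{k=1}^d[\![\mathcal U_1,\dots,\mathcal U_{k-1},\dot{\mathcal U}_k,\mathcal U_{k+1},\dots,\mathcal U_d]\!]$ with $\dot{\mathcal U}_k\in\mathbb C^{r_{k-1}\times n_k\times r_k}$ and $\mathrm L(\dot{\mathcal U}_k)^\dagger\mathrm L(\mathcal U_k)=0$ for $k=1,\dots,d-1$. Convention: the tangent space of $\mathcal B_1$ at $\mathcal X\in\mathcal B_1$ is $\mathrm T_{\mathcal X}\mathcal B_1=\{\mathcal V\in\mathbb C^{n_1\times\cdots\times n_d}:\langle\mathcal V,\mathcal X\rangle=0\}$, and $\mathrm T_{\mathcal X}\mathcal N_{\mathbf r}=\mathrm T_{\mathcal X}\mathcal M_{\mathbf r}\cap\mathrm T_{\mathcal X}\mathcal B_1$. *)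

theory Defs
  imports Complex_Main
    "HOL-Library.FuncSet"
    "Jordan_Normal_Form.Schur_Decomposition"
    "Jordan_Normal_Form.DL_Rank"
begin

text \<open>
  A tensor of size \<open>n 1 \<times> \<dots> \<times> n d\<close> is a complex function of multi-indices
  \<open>i = (i 1, \<dots>, i d)\<close>. Modes are numbered from 1 and the values \<open>i k\<close> of an index
  from 0. Tensors vanish outside the index set, so that equality and sums of tensors are
  equality and sums of functions.
\<close>

type_synonym tensor = "(nat \<Rightarrow> nat) \<Rightarrow> complex"

definition indices :: "nat \<Rightarrow> (nat \<Rightarrow> nat) \<Rightarrow> (nat \<Rightarrow> nat) set" where
  "indices d n = (\<Pi>\<^sub>E k\<in>{1..d}. {..<n k})"

definition tensors :: "nat \<Rightarrow> (nat \<Rightarrow> nat) \<Rightarrow> tensor set" where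
  "tensors d n = {X. \<forall>i. i \<notin> indices d n \<longrightarrow> X i = 0}"

definition tensor_inner :: "nat \<Rightarrow> (nat \<Rightarrow> nat) \<Rightarrow> tensor \<Rightarrow> tensor \<Rightarrow> complex" where
  "tensor_inner d n X Y = (\<Sum>i\<in>indices d n. cnj (X i) * Y i)"

definition frobenius_norm :: "nat \<Rightarrow> (nat \<Rightarrow> nat) \<Rightarrow> tensor \<Rightarrow> real" where
  "frobenius_norm d n X = sqrt (Re (tensor_inner d n X X))"

text \<open>
  The multi-indices \<open>(i 1, \<dots>, i k)\<close> and \<open>(i (k+1), \<dots>, i d)\<close> are numbered in mixed radix
  with the first index running fastest; \<open>split_index d n k p q\<close> is the multi-index belonging
  to row \<open>p\<close> and column \<open>q\<close> of the unfolding.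
\<close>

definition split_index :: "nat \<Rightarrow> (nat \<Rightarrow> nat) \<Rightarrow> nat \<Rightarrow> nat \<Rightarrow> nat \<Rightarrow> nat \<Rightarrow> nat" where
  "split_index d n k p q = (\<lambda>j\<in>{1..d}.
     if j \<le> k then (p div (\<Prod>l\<in>{1..<j}. n l)) mod n j
     else (q div (\<Prod>l\<in>{k+1..<j}. n l)) mod n j)"

definition unfolding_mat :: "nat \<Rightarrow> (nat \<Rightarrow> nat) \<Rightarrow> nat \<Rightarrow> tensor \<Rightarrow> complex mat" where
  "unfolding_mat d n k X =
     mat (\<Prod>l\<in>{1..k}. n l) (\<Prod>l\<in>{k+1..d}. n l) (\<lambda>(p, q). X (split_index d n k p q))"

definition mat_rank :: "complex mat \<Rightarrow> nat" where
  "mat_rank A = vec_space.rank (dim_row A) A"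

definition tt_rank :: "nat \<Rightarrow> (nat \<Rightarrow> nat) \<Rightarrow> tensor \<Rightarrow> nat \<Rightarrow> nat" where
  "tt_rank d n X k = (if k = 0 \<or> k = d then 1 else mat_rank (unfolding_mat d n k X))"

text \<open>
  A core of size \<open>p \<times> m \<times> q\<close> is given by its slices \<open>C i\<close> for \<open>i < m\<close>, which
  are \<open>p \<times> q\<close> matrices. Values \<open>C i\<close> with \<open>i \<ge> m\<close> are never used.
\<close>

type_synonym core = "nat \<Rightarrow> complex mat"

definition is_core :: "nat \<Rightarrow> nat \<Rightarrow> nat \<Rightarrow> core \<Rightarrow> bool" where
  "is_core p m q C \<longleftrightarrow> (\<forall>i<m. C i \<in> carrier_mat p q)"

definition core_inner :: "nat \<Rightarrow> nat \<Rightarrow> nat \<Rightarrow> core \<Rightarrow> core \<Rightarrow> complex" where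
  "core_inner p m q C D = (\<Sum>a<p. \<Sum>i<m. \<Sum>b<q. cnj (C i $$ (a, b)) * D i $$ (a, b))"

definition left_unfolding :: "nat \<Rightarrow> nat \<Rightarrow> nat \<Rightarrow> core \<Rightarrow> complex mat" where
  "left_unfolding p m q C = mat (p * m) q (\<lambda>(s, b). C (s div p) $$ (s mod p, b))"

definition are_cores ::
  "nat \<Rightarrow> (nat \<Rightarrow> nat) \<Rightarrow> (nat \<Rightarrow> nat) \<Rightarrow> (nat \<Rightarrow> core) \<Rightarrow> bool" where
  "are_cores d n r U \<longleftrightarrow> (\<forall>k\<in>{1..d}. is_core (r (k - 1)) (n k) (r k) (U k))"

definition left_orthogonal ::
  "nat \<Rightarrow> (nat \<Rightarrow> nat) \<Rightarrow> (nat \<Rightarrow> nat) \<Rightarrow> (nat \<Rightarrow> core) \<Rightarrow> bool" where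
  "left_orthogonal d n r U \<longleftrightarrow> (\<forall>k\<in>{1..d-1}.
     mat_adjoint (left_unfolding (r (k - 1)) (n k) (r k) (U k))
       * left_unfolding (r (k - 1)) (n k) (r k) (U k) = 1\<^sub>m (r k))"

text \<open>
  \<open>core_prod U i k\<close> is the product of \<open>U 1 (i 1), \<dots>, U k (i k)\<close>; the empty product is the
  identity of size \<open>r 0 = 1\<close>. For \<open>k = d\<close> it is a \<open>1 \<times> 1\<close> matrix since \<open>r d = 1\<close>.
\<close>

primrec core_prod :: "(nat \<Rightarrow> core) \<Rightarrow> (nat \<Rightarrow> nat) \<Rightarrow> nat \<Rightarrow> complex mat" where
  "core_prod U i 0 = 1\<^sub>m 1"
| "core_prod U i (Suc k) = core_prod U i k * U (Suc k) (i (Suc k))"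

definition tt :: "nat \<Rightarrow> (nat \<Rightarrow> nat) \<Rightarrow> (nat \<Rightarrow> core) \<Rightarrow> tensor" where
  "tt d n U = (\<lambda>i. if i \<in> indices d n then core_prod U i d $$ (0, 0) else 0)"

definition tt_manifold :: "nat \<Rightarrow> (nat \<Rightarrow> nat) \<Rightarrow> (nat \<Rightarrow> nat) \<Rightarrow> tensor set" where
  "tt_manifold d n r = {X \<in> tensors d n. \<forall>k\<le>d. tt_rank d n X k = r k}"

definition unit_sphere :: "nat \<Rightarrow> (nat \<Rightarrow> nat) \<Rightarrow> tensor set" where
  "unit_sphere d n = {X \<in> tensors d n. frobenius_norm d n X = 1}"

definition normalized_tt_manifold :: "nat \<Rightarrow> (nat \<Rightarrow> nat) \<Rightarrow> (nat \<Rightarrow> nat) \<Rightarrow> tensor set" where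
  "normalized_tt_manifold d n r = tt_manifold d n r \<inter> unit_sphere d n"

text \<open>
  The tangent space at \<open>X\<close> of a submanifold \<open>M\<close> of the tensor space: the velocities at time 0
  of the continuously differentiable curves in \<open>M\<close> through \<open>X\<close>. The tensor space being
  finite-dimensional, curves are differentiated entrywise. The curve parameter is real; for a
  complex submanifold the velocities nevertheless form a complex subspace.
\<close>

definition tangent_space :: "tensor set \<Rightarrow> tensor \<Rightarrow> tensor set" where
  "tangent_space M X = {V. \<exists>(\<gamma> :: real \<Rightarrow> tensor) (\<gamma>' :: real \<Rightarrow> tensor) (\<epsilon> :: real).
     \<epsilon> > 0 \<and> \<gamma> 0 = X \<and> \<gamma>' 0 = V \<and>
     (\<forall>t\<in>{-\<epsilon><..<\<epsilon>}. \<gamma> t \<in> M) \<and>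
     (\<forall>i. \<forall>t\<in>{-\<epsilon><..<\<epsilon>}. ((\<lambda>s. \<gamma> s i) has_vector_derivative \<gamma>' t i) (at t)) \<and>
     (\<forall>i. continuous_on {-\<epsilon><..<\<epsilon>} (\<lambda>t. \<gamma>' t i))}"

text \<open>
  By convention the tangent space of the unit sphere is the complex orthogonal complement of
  \<open>X\<close>, not the real one (\<open>Re \<langle>V, X\<rangle> = 0\<close>) that curves in the sphere would give; the tangent
  space of the normalized manifold is the resulting intersection.
\<close>

definition sphere_tangent :: "nat \<Rightarrow> (nat \<Rightarrow> nat) \<Rightarrow> tensor \<Rightarrow> tensor set" where
  "sphere_tangent d n X = {V \<in> tensors d n. tensor_inner d n V X = 0}"

definition normalized_tt_tangent ::
  "nat \<Rightarrow> (nat \<Rightarrow> nat) \<Rightarrow> (nat \<Rightarrow> nat) \<Rightarrow> tensor \<Rightarrow> tensor set" where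
  "normalized_tt_tangent d n r X = tangent_space (tt_manifold d n r) X \<inter> sphere_tangent d n X"

end

theory Submission
  imports Defs
begin

text \<open>
  Write \<open>L k\<close> for the matrix whose rows are the products \<open>U 1 (i 1) \<cdots> U k (i k)\<close> of the first \<open>k\<close>
  slices and \<open>R k\<close> for the matrix whose columns are the products of the remaining ones, so that the
  \<open>k\<close>-th unfolding of \<open>X\<close> is \<open>L k * R k\<close>. Left-orthogonality of the cores makes the columns of
  \<open>L k\<close> orthonormal for \<open>k < d\<close>, and the rank condition makes the rows of \<open>R k\<close> independent.

  A sum of tensors of the stated form is the velocity of \<open>t \<mapsto> tt d n (U + t \<cdot> dU)\<close>. All
  unfoldings of this curve factor through \<open>r k\<close> columns, and rank cannot drop near \<open>t = 0\<close>,
  so the curve stays in the manifold for small \<open>t\<close> (\<open>tt_tangent_superset\<close>).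

  Conversely let \<open>V\<close> be the velocity of a curve in the manifold. For every unfolding, a curve of
  matrices of rank at most \<open>q\<close> through a matrix of rank \<open>q\<close> has a velocity that vanishes when compressed
  to the left and right kernels of that matrix
  (\<open>bounded_rank_tangent_compression\<close>). Hence the \<open>k\<close>-th unfolding of \<open>V\<close> is \<open>L k * C k + W k * R k\<close>
  with the columns of \<open>W k\<close> orthogonal to those of \<open>L k\<close> and \<open>C k = (L k)\<^sup>* V\<close>
  (\<open>tangent_unfolding_split\<close>). Now the orthogonal projections \<open>L k * (L k)\<^sup>*\<close> telescope:
  \<open>L k * C k\<close> is \<open>L (k+1) * C (k+1)\<close> plus the \<open>(k+1)\<close>-st term of the tangent form, whose core
  is \<open>W (k+1)\<close> projected onto the column span of \<open>L k\<close> (\<open>left_coefficient_step\<close>). Starting from \<open>V = L 0 * C 0\<close>, this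
  peels off one core variation at a time; what remains at \<open>d - 1\<close> is the last term, whose core is
  unrestricted (\<open>tt_tangent_subset\<close>).

  Finally, the gauge conditions make all terms but the last orthogonal to \<open>X\<close>, and the inner
  product of the last one with \<open>X\<close> equals the inner product of the last cores
  (\<open>tensor_inner_tangent\<close>). So orthogonality to \<open>X\<close> is precisely the condition on \<open>dU d\<close>.
\<close>

section \<open>Rank and factorizations\<close>

text \<open>
  The rank is defined as the dimension of the column span; a maximal independent set of columns
  realizes it, since any column outside its span could be added.
\<close>
lemma (in vec_space) rank_independent_columns:
  assumes A: "A \<in> carrier_mat n nc"
  obtains S where "S \<subseteq> set (cols A)" "lin_indpt S" "card S = rank A" "set (cols A) \<subseteq> span S"
proof -
  have cA: "set (cols A) \<subseteq> carrier_vec n" using A cols_dim by fastforce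
  obtain S where S: "maximal S (\<lambda>T. T \<subseteq> set (cols A) \<and> lin_indpt T)"
    using maximal_exists[of "(\<lambda>T. T \<subseteq> set (cols A) \<and> lin_indpt T)" "card (set (cols A))" "{}"]
    by (meson List.finite_set card_mono empty_iff empty_subsetI finite_lin_indpt2 rev_finite_subset)
  then have Ssub: "S \<subseteq> set (cols A)" and Sind: "lin_indpt S" by (auto simp: maximal_def)
  have Sc: "S \<subseteq> carrier_vec n" using Ssub cA by blast
  have "v \<in> span S" if v: "v \<in> set (cols A)" for v
  proof (rule ccontr)
    assume n: "v \<notin> span S"
    have vc: "v \<in> carrier_vec n" using v cA by blast
    have nS: "v \<notin> S" using n span_mem[of S v] Sc by auto
    have "lin_indpt (S \<union> {v})"
      using lin_dep_iff_in_span[OF Sc Sind vc nS] n by blast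
    moreover have "S \<union> {v} \<subseteq> set (cols A)" using Ssub v by blast
    ultimately have "S \<union> {v} = S" using S unfolding maximal_def by blast
    then show False using nS by blast
  qed
  then have "set (cols A) \<subseteq> span S" by blast
  with Ssub Sind rank_card_indpt[OF A S] show ?thesis using that by metis
qed

lemma mult_mat_columns_factor:
  fixes A P :: "complex mat"
  assumes A: "A \<in> carrier_mat m n" and P: "P \<in> carrier_mat m q"
    and cols: "\<And>j. j < n \<Longrightarrow> \<exists>x \<in> carrier_vec q. P *\<^sub>v x = col A j"
  shows "\<exists>Q \<in> carrier_mat q n. A = P * Q"
proof -
  obtain x where x: "\<And>j. j < n \<Longrightarrow> x j \<in> carrier_vec q \<and> P *\<^sub>v x j = col A j"
    using cols by metis
  define Q where "Q = mat q n (\<lambda>(a, j). x j $ a)"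
  have Q: "Q \<in> carrier_mat q n" by (simp add: Q_def)
  have colQ: "col Q j = x j" if "j < n" for j
    using x[OF that] that by (auto simp: Q_def intro!: eq_vecI)
  have "A = P * Q"
  proof (rule eq_matI)
    fix i j assume "i < dim_row (P * Q)" "j < dim_col (P * Q)"
    then have ij: "i < m" "j < n" using P Q by auto
    have "A $$ (i, j) = col A j $ i" using A ij by simp
    also have "\<dots> = (P *\<^sub>v x j) $ i" using x ij by simp
    finally show "A $$ (i, j) = (P * Q) $$ (i, j)" using P Q ij colQ by simp
  qed (use A P Q in auto)
  then show ?thesis using Q by blast
qed

text \<open>
  Every column of \<open>P * Q\<close> is a combination of the \<open>q\<close> columns of \<open>P\<close>.
\<close>
lemma mat_rank_mult_le:
  assumes P: "P \<in> carrier_mat m q" and Q: "Q \<in> carrier_mat q n"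
  shows "mat_rank (P * Q) \<le> q"
proof -
  interpret vec_space "TYPE(complex)" m .
  have PQ: "P * Q \<in> carrier_mat m n" using P Q by simp
  have "set (cols (P * Q)) \<subseteq> span (set (cols P))"
  proof
    fix v assume "v \<in> set (cols (P * Q))"
    then obtain j where j: "j < n" "v = col (P * Q) j"
      using PQ by (auto simp: cols_def)
    then have "v = P *\<^sub>v col Q j" using P Q by (auto simp: mult_mat_vec_def intro!: eq_vecI)
    moreover have "P *\<^sub>v col Q j \<in> carrier_vec (dim_row P)" "col Q j \<in> carrier_vec (dim_col P)"
      using P Q j by auto
    ultimately show "v \<in> span (set (cols P))"
      using col_space_eq[OF P] unfolding col_space_def by blast
  qed
  moreover have cP: "set (cols P) \<subseteq> carrier_vec m" using P cols_dim by blast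
  ultimately have sub: "span (set (cols (P * Q))) \<subseteq> span (set (cols P))"
    using span_is_subset[OF _ span_is_submodule] by simp
  have s1: "VectorSpace.subspace class_ring (span (set (cols P))) V" using cP span_is_subspace by simp
  have s2: "VectorSpace.subspace class_ring (span (set (cols (P * Q)))) V"
    using PQ cols_dim span_is_subspace by (metis carrier_matD(1) module_vec_simps(3))
  have "rank (P * Q) \<le> rank P"
    unfolding rank_def
    using vectorspace.subspace_dim[OF subspace_is_vs[OF s1] nested_subspaces[OF s1 s2 sub]
        fin_dim_span_cols[OF P]] fin_dim_span_cols[OF PQ] by simp
  also have "\<dots> \<le> q" by (rule rank_le_nc[OF P])
  finally show ?thesis using P unfolding mat_rank_def by simp
qed

text \<open>
  Take a basis of the column span for the columns of \<open>P\<close> and the coordinates of the columns of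
  \<open>A\<close> for those of \<open>Q\<close>. This is the form in which the rank is used below: it turns rank bounds
  into bounds on the inner dimension of a product.
\<close>
lemma mat_rank_factorization:
  assumes A: "A \<in> carrier_mat m n"
  obtains P Q where "P \<in> carrier_mat m (mat_rank A)" "Q \<in> carrier_mat (mat_rank A) n" "A = P * Q"
proof -
  interpret vec_space "TYPE(complex)" m .
  obtain S where Ssub: "S \<subseteq> set (cols A)" and cS: "card S = rank A"
    and sp: "set (cols A) \<subseteq> span S" using rank_independent_columns[OF A] by metis
  have cA: "set (cols A) \<subseteq> carrier_vec m" using A cols_dim by blast
  have rk: "mat_rank A = card S"
    using cS A by (simp add: mat_rank_def)
  have "finite S" using Ssub finite_subset by blast
  then obtain ss where ss: "set ss = S" "distinct ss" using finite_distinct_list by blast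
  have len: "length ss = mat_rank A" using ss rk distinct_card by metis
  define P where "P = mat_of_cols m ss"
  have P: "P \<in> carrier_mat m (mat_rank A)" using mat_of_cols_carrier(1)[of m ss] by (simp add: P_def len)
  have colsP: "cols P = ss" unfolding P_def using ss Ssub cA by (intro cols_mat_of_cols) auto
  have "\<exists>x \<in> carrier_vec (mat_rank A). P *\<^sub>v x = col A j" if "j < n" for j
  proof -
    have "col A j \<in> span (set (cols P))" using sp that A colsP ss by (auto simp: cols_def)
    then show ?thesis using col_space_eq[OF P] P unfolding col_space_def by auto
  qed
  from mult_mat_columns_factor[OF A P this] that P show ?thesis by blast
qed

text \<open>
  A compression to size \<open>s\<close> cannot have larger rank than the matrix itself. This replaces
  minors: \<open>F\<close> and \<open>G\<close> may be arbitrary, not just selections of rows and columns.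
\<close>
lemma det_compression_eq_0:
  assumes A: "A \<in> carrier_mat m n" and F: "F \<in> carrier_mat s m" and G: "G \<in> carrier_mat n s"
    and less: "mat_rank A < s"
  shows "det (F * A * G) = 0"
proof (rule ccontr)
  assume nz: "det (F * A * G) \<noteq> 0"
  obtain P Q where PQ: "P \<in> carrier_mat m (mat_rank A)" "Q \<in> carrier_mat (mat_rank A) n" "A = P * Q"
    using mat_rank_factorization[OF A] .
  have "F * A = F * P * Q" using F PQ by (simp add: assoc_mult_mat[OF F PQ(1,2)])
  then have "F * A * G = (F * P) * (Q * G)"
    using assoc_mult_mat[OF mult_carrier_mat[OF F PQ(1)] PQ(2) G] by simp
  then have "mat_rank (F * A * G) \<le> mat_rank A"
    using mat_rank_mult_le[of "F * P" s "mat_rank A" "Q * G" s] F G PQ(1,2) by simp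
  moreover have "mat_rank (F * A * G) = s"
    using vec_space.low_rank_det_zero[OF _ nz] F G A unfolding mat_rank_def by simp
  ultimately show False using less by simp
qed

text \<open>
  A maximal independent set of columns has \<open>q\<close> elements and is therefore a basis of the whole
  space, so that every unit vector is a combination of columns of \<open>R\<close>.
\<close>
lemma full_row_rank_right_inverse:
  assumes R: "R \<in> carrier_mat q n" and rk: "mat_rank R = q"
  obtains S where "S \<in> carrier_mat n q" "R * S = 1\<^sub>m q"
proof -
  interpret vec_space "TYPE(complex)" q .
  obtain S where Ssub: "S \<subseteq> set (cols R)" and Sind: "lin_indpt S" and cS: "card S = rank R"
    using rank_independent_columns[OF R] by metis
  have cR: "set (cols R) \<subseteq> carrier_vec q" using R cols_dim by blast
  have "card S = q" using cS R rk by (simp add: mat_rank_def)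
  then have "basis S" 
    using dim_li_is_basis[of S] Ssub cR Sind dim_is_n finite_subset[OF Ssub] by auto
  then have "carrier_vec q = span S" by (simp add: basis_def)
  then have full: "carrier_vec q = span (set (cols R))"
    using span_is_monotone[OF Ssub] span_is_subset2[of "set (cols R)"] cR by auto
  have "\<exists>x \<in> carrier_vec n. R *\<^sub>v x = col (1\<^sub>m q) j" if "j < q" for j
  proof -
    have "col (1\<^sub>m q :: complex mat) j \<in> span (set (cols R))" using full that by auto
    then show ?thesis using col_space_eq[OF R] R unfolding col_space_def by auto
  qed
  from mult_mat_columns_factor[OF one_carrier_mat R this] that show ?thesis by metis
qed

text \<open>
  If the inner dimension of a factorization equals the rank of the product, the right factor has
  full row rank: otherwise factoring it would give a factorization of the product with smaller
  inner dimension.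
\<close>
lemma factor_right_inverse:
  assumes L: "L \<in> carrier_mat m q" and R: "R \<in> carrier_mat q n" and rk: "mat_rank (L * R) = q"
  obtains S where "S \<in> carrier_mat n q" "R * S = 1\<^sub>m q"
proof -
  obtain P Q where PQ: "P \<in> carrier_mat q (mat_rank R)" "Q \<in> carrier_mat (mat_rank R) n" "R = P * Q"
    using mat_rank_factorization[OF R] .
  have "L * R = (L * P) * Q" using assoc_mult_mat[OF L PQ(1,2)] PQ(3) by simp
  then have "q \<le> mat_rank R"
    using mat_rank_mult_le[OF mult_carrier_mat[OF L PQ(1)] PQ(2)] rk by simp
  moreover have "mat_rank R \<le> q"
    using mat_rank_mult_le[OF one_carrier_mat R] R by simp
  ultimately have "mat_rank R = q" by simp
  then show ?thesis using full_row_rank_right_inverse[OF R] that by blast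
qed

lemma triple_product_entry:
  assumes "F \<in> carrier_mat s m" "A \<in> carrier_mat m n" "G \<in> carrier_mat n t" "a < s" "c < t"
  shows "(F * A * G) $$ (a, c) = (\<Sum>p<m. \<Sum>q<n. F $$ (a, p) * A $$ (p, q) * G $$ (q, c))"
proof -
  have "(F * A * G) $$ (a, c) = (\<Sum>q<n. (\<Sum>p<m. F $$ (a, p) * A $$ (p, q)) * G $$ (q, c))"
    using assms by (auto simp: scalar_prod_def atLeast0LessThan simp del: assoc_mult_mat intro!: sum.cong)
  also have "\<dots> = (\<Sum>q<n. \<Sum>p<m. F $$ (a, p) * A $$ (p, q) * G $$ (q, c))"
    by (simp add: sum_distrib_right)
  also have "\<dots> = (\<Sum>p<m. \<Sum>q<n. F $$ (a, p) * A $$ (p, q) * G $$ (q, c))"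
    by (rule sum.swap)
  finally show ?thesis .
qed

lemma tendsto_det:
  fixes M :: "'x \<Rightarrow> complex mat"
  assumes "\<And>t. M t \<in> carrier_mat s s" and "M0 \<in> carrier_mat s s"
    and "\<And>a c. a < s \<Longrightarrow> c < s \<Longrightarrow> ((\<lambda>t. M t $$ (a, c)) \<longlongrightarrow> M0 $$ (a, c)) H"
  shows "((\<lambda>t. det (M t)) \<longlongrightarrow> det M0) H"
proof -
  have "((\<lambda>t. \<Sum>p\<in>{p. p permutes {0..<s}}. signof p * (\<Prod>i = 0..<s. M t $$ (i, p i)))
      \<longlongrightarrow> (\<Sum>p\<in>{p. p permutes {0..<s}}. signof p * (\<Prod>i = 0..<s. M0 $$ (i, p i)))) H"
    by (intro tendsto_sum tendsto_mult tendsto_const tendsto_prod assms(3))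
       (use permutes_in_image in fastforce)+
  then show ?thesis by (simp add: det_def'[OF assms(1)] det_def'[OF assms(2)])
qed

text \<open>
  The determinant of the compression is continuous in \<open>t\<close> and equals 1 at \<open>t = 0\<close>, so it stays nonzero nearby,
  which a smaller rank would not allow.
\<close>
lemma mat_rank_lower_semicontinuous:
  fixes A :: "real \<Rightarrow> complex mat"
  assumes A: "\<And>t. A t \<in> carrier_mat m n"
    and cont: "\<And>i j. i < m \<Longrightarrow> j < n \<Longrightarrow> isCont (\<lambda>t. A t $$ (i, j)) 0"
    and K: "K \<in> carrier_mat q m" and S: "S \<in> carrier_mat n q" and one: "K * A 0 * S = 1\<^sub>m q"
  shows "\<forall>\<^sub>F t in nhds 0. q \<le> mat_rank (A t)"
proof -
  have "((\<lambda>t. (K * A t * S) $$ (a, c)) \<longlongrightarrow> (K * A 0 * S) $$ (a, c)) (nhds 0)" if ac: "a < q" "c < q" for a c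
  proof -
    have l: "((\<lambda>t. A t $$ (i, j)) \<longlongrightarrow> A 0 $$ (i, j)) (nhds 0)" if "i < m" "j < n" for i j
      using cont[OF that] tendsto_at_iff_tendsto_nhds[of "\<lambda>t. A t $$ (i, j)" 0] by (simp add: isCont_def)
    show ?thesis unfolding triple_product_entry[OF K A S ac]
      by (intro tendsto_intros l) auto
  qed
  then have "((\<lambda>t. det (K * A t * S)) \<longlongrightarrow> det (K * A 0 * S)) (nhds 0)"
    by (intro tendsto_det[where s = q] mult_carrier_mat[OF mult_carrier_mat[OF K A] S])
  moreover have "det (K * A 0 * S) \<noteq> 0" by (simp add: one)
  ultimately have "\<forall>\<^sub>F t in nhds 0. det (K * A t * S) \<noteq> 0" by (rule tendsto_imp_eventually_ne)
  then show ?thesis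
  proof (rule eventually_mono)
    fix t assume "det (K * A t * S) \<noteq> 0"
    then show "q \<le> mat_rank (A t)" using det_compression_eq_0[OF A K S] by (meson not_le)
  qed
qed

section \<open>Velocities of matrix curves of bounded rank\<close>

text \<open>
  The rows of \<open>Y\<close> annihilate \<open>A 0\<close> from the left, and the columns of \<open>Z\<close> annihilate it from the right.
  For an entry \<open>(i, j)\<close> of \<open>Y * A' * Z\<close>, border the compression \<open>K * A h * S\<close>, which is the
  identity at \<open>h = 0\<close>, by row \<open>i\<close> of \<open>Y\<close> and by column \<open>j\<close> of \<open>Z\<close> divided by \<open>h\<close>. The result has size
  \<open>q + 1\<close>, hence determinant 0 for all small \<open>h\<close>. Since \<open>A 0 * Z = 0\<close>, the division by \<open>h\<close>
  produces difference quotients, and as \<open>h\<close> tends to 0 the matrix converges to an upper triangular one with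
  diagonal \<open>1, \<dots>, 1, (Y * A' * Z)(i, j)\<close>, whose determinant is the entry in question.
\<close>
lemma bounded_rank_tangent_compression:
  fixes A :: "real \<Rightarrow> complex mat"
  assumes eps: "\<epsilon> > 0"
    and A: "\<And>t. A t \<in> carrier_mat m n"
    and rk: "\<And>t. t \<in> {-\<epsilon><..<\<epsilon>} \<Longrightarrow> mat_rank (A t) \<le> q"
    and deriv: "\<And>i j. i < m \<Longrightarrow> j < n \<Longrightarrow>
      ((\<lambda>t. A t $$ (i, j)) has_vector_derivative A' $$ (i, j)) (at 0)"
    and A': "A' \<in> carrier_mat m n"
    and L: "L \<in> carrier_mat m q" and R: "R \<in> carrier_mat q n" and A0: "A 0 = L * R"
    and K: "K \<in> carrier_mat q m" "K * L = 1\<^sub>m q" and S: "S \<in> carrier_mat n q" "R * S = 1\<^sub>m q"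
    and Y: "Y \<in> carrier_mat s m" "Y * L = 0\<^sub>m s q" and Z: "Z \<in> carrier_mat n t" "R * Z = 0\<^sub>m q t"
  shows "Y * A' * Z = 0\<^sub>m s t"
proof (rule eq_matI)
  fix i j assume "i < dim_row (0\<^sub>m s t)" "j < dim_col (0\<^sub>m s t)"
  then have i: "i < s" and j: "j < t" by auto
  define F where "F = mat (Suc q) m (\<lambda>(a, p). if a < q then K $$ (a, p) else Y $$ (i, p))"
  define G where "G h = mat n (Suc q) (\<lambda>(p, c). if c < q then S $$ (p, c) else Z $$ (p, j) / complex_of_real h)" for h
  \<comment> \<open>The last column of the limit of the bordered matrix.\<close>
  define x where "x a = (\<Sum>p<m. \<Sum>u<n. F $$ (a, p) * A' $$ (p, u) * Z $$ (u, j))" for a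
  define M0 where "M0 = mat (Suc q) (Suc q) (\<lambda>(a, c). if c = q then x a else if a = c then 1 else 0)"
  have F: "F \<in> carrier_mat (Suc q) m" and G: "G h \<in> carrier_mat n (Suc q)" for h
    by (auto simp: F_def G_def)
  have FL: "(\<Sum>p<m. F $$ (a, p) * L $$ (p, c)) = (if a = c then 1 else 0)" if "a < Suc q" "c < q" for a c
  proof (cases "a < q")
    case True
    then have "(\<Sum>p<m. F $$ (a, p) * L $$ (p, c)) = (K * L) $$ (a, c)"
      using that K(1) L by (auto simp: F_def scalar_prod_def atLeast0LessThan intro!: sum.cong)
    then show ?thesis using True that K(2) by simp
  next
    case False
    then have "(\<Sum>p<m. F $$ (a, p) * L $$ (p, c)) = (Y * L) $$ (i, c)"
      using that Y(1) L i by (auto simp: F_def scalar_prod_def atLeast0LessThan intro!: sum.cong)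
    then show ?thesis using False that Y(2) i by simp
  qed
  have A0S: "A 0 * S = L" using A0 assoc_mult_mat[OF L R S(1)] S(2) L by simp
  have A0Z: "A 0 * Z = 0\<^sub>m m t" using A0 assoc_mult_mat[OF L R Z(1)] Z(2) L by simp
  have A0Zj: "(\<Sum>u<n. A 0 $$ (p, u) * Z $$ (u, j)) = 0" if "p < m" for p
  proof -
    have "(\<Sum>u<n. A 0 $$ (p, u) * Z $$ (u, j)) = (A 0 * Z) $$ (p, j)"
      using that j Z(1) A[of 0] by (auto simp: scalar_prod_def atLeast0LessThan)
    then show ?thesis using A0Z that j by simp
  qed
  have cont: "((\<lambda>h. A h $$ (p, u)) \<longlongrightarrow> A 0 $$ (p, u)) (at 0)" if "p < m" "u < n" for p u
    using has_vector_derivative_continuous[OF deriv[OF that]] by (simp add: continuous_at)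
  have quot: "((\<lambda>h. (A h $$ (p, u) - A 0 $$ (p, u)) / complex_of_real h) \<longlongrightarrow> A' $$ (p, u)) (at 0)"
    if "p < m" "u < n" for p u
  proof -
    have "((\<lambda>h. norm ((A h $$ (p, u) - A 0 $$ (p, u) - h *\<^sub>R A' $$ (p, u)) / complex_of_real h)) \<longlongrightarrow> 0) (at 0)"
      using deriv[OF that] unfolding has_vector_derivative_def
      by (simp add: has_derivative_iff_norm norm_divide)
    then have "((\<lambda>h. (A h $$ (p, u) - A 0 $$ (p, u) - h *\<^sub>R A' $$ (p, u)) / complex_of_real h) \<longlongrightarrow> 0) (at 0)"
      by (rule tendsto_norm_zero_cancel)
    then have "((\<lambda>h. (A h $$ (p, u) - A 0 $$ (p, u)) / complex_of_real h - A' $$ (p, u)) \<longlongrightarrow> 0) (at 0)"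
      by (rule Lim_transform_eventually)
        (simp add: eventually_at_filter diff_divide_distrib scaleR_conv_of_real)
    then show ?thesis by (rule LIM_zero_cancel)
  qed
  have lim: "((\<lambda>h. (F * A h * G h) $$ (a, c)) \<longlongrightarrow> M0 $$ (a, c)) (at 0)"
    if a: "a < Suc q" and c: "c < Suc q" for a c
  proof (cases "c < q")
    case True
    have "((\<lambda>h. \<Sum>p<m. \<Sum>u<n. F $$ (a, p) * A h $$ (p, u) * S $$ (u, c))
        \<longlongrightarrow> (\<Sum>p<m. \<Sum>u<n. F $$ (a, p) * A 0 $$ (p, u) * S $$ (u, c))) (at 0)"
      by (intro tendsto_intros cont) auto
    moreover have "(F * A h * G h) $$ (a, c) = (\<Sum>p<m. \<Sum>u<n. F $$ (a, p) * A h $$ (p, u) * S $$ (u, c))" for h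
      using triple_product_entry[OF F A G a c] True by (simp add: G_def)
    moreover have "(\<Sum>p<m. \<Sum>u<n. F $$ (a, p) * A 0 $$ (p, u) * S $$ (u, c)) = M0 $$ (a, c)"
    proof -
      have "(\<Sum>u<n. A 0 $$ (p, u) * S $$ (u, c)) = L $$ (p, c)" if "p < m" for p
      proof -
        have "(A 0 * S) $$ (p, c) = (\<Sum>u<n. A 0 $$ (p, u) * S $$ (u, c))"
          using that A[of 0] S(1) True by (auto simp: scalar_prod_def atLeast0LessThan)
        then show ?thesis using A0S by simp
      qed
      then have "(\<Sum>p<m. \<Sum>u<n. F $$ (a, p) * A 0 $$ (p, u) * S $$ (u, c))
          = (\<Sum>p<m. F $$ (a, p) * L $$ (p, c))"
        by (simp add: mult.assoc flip: sum_distrib_left)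
      then show ?thesis using FL[OF a True] a c True by (simp add: M0_def)
    qed
    ultimately show ?thesis by simp
  next
    case False
    have "((\<lambda>h. \<Sum>p<m. \<Sum>u<n. F $$ (a, p) * ((A h $$ (p, u) - A 0 $$ (p, u)) / complex_of_real h) * Z $$ (u, j))
        \<longlongrightarrow> x a) (at 0)"
      unfolding x_def by (intro tendsto_intros quot) auto
    moreover have "(F * A h * G h) $$ (a, c)
        = (\<Sum>p<m. \<Sum>u<n. F $$ (a, p) * ((A h $$ (p, u) - A 0 $$ (p, u)) / complex_of_real h) * Z $$ (u, j))" for h
    proof -
      have "(\<Sum>p<m. \<Sum>u<n. F $$ (a, p) * (A 0 $$ (p, u) / complex_of_real h) * Z $$ (u, j))
        = (\<Sum>p<m. F $$ (a, p) / complex_of_real h * (\<Sum>u<n. A 0 $$ (p, u) * Z $$ (u, j)))"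
        by (simp add: sum_distrib_left mult.assoc)
      also have "\<dots> = 0" using A0Zj by simp
      finally have z: "(\<Sum>p<m. \<Sum>u<n. F $$ (a, p) * (A 0 $$ (p, u) / complex_of_real h) * Z $$ (u, j)) = 0" .
      have "(F * A h * G h) $$ (a, c)
          = (\<Sum>p<m. \<Sum>u<n. F $$ (a, p) * (A h $$ (p, u) / complex_of_real h) * Z $$ (u, j))"
        using triple_product_entry[OF F A G a c] False c by (simp add: G_def)
      then show ?thesis using z
        by (simp add: diff_divide_distrib left_diff_distrib right_diff_distrib sum_subtractf)
    qed
    moreover have "c = q" using c False by simp
    ultimately show ?thesis using a by (simp add: M0_def)
  qed
  have "((\<lambda>h. det (F * A h * G h)) \<longlongrightarrow> det M0) (at 0)"
    by (rule tendsto_det[OF mult_carrier_mat[OF mult_carrier_mat[OF F A] G] _ lim]) (auto simp: M0_def)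
  moreover have "det (F * A h * G h) = 0" if "h \<in> {-\<epsilon><..<\<epsilon>}" for h
    using det_compression_eq_0[OF A F G] rk[OF that] by simp
  then have "\<forall>\<^sub>F h in at 0. det (F * A h * G h) = 0"
    using eps unfolding eventually_at by (intro exI[of _ \<epsilon>]) (auto simp: dist_real_def abs_less_iff)
  then have "((\<lambda>h. det (F * A h * G h)) \<longlongrightarrow> 0) (at 0)" by (rule tendsto_eventually)
  ultimately have "det M0 = 0" by (rule LIM_unique)
  moreover have "det M0 = prod_list (diag_mat M0)"
    by (rule det_upper_triangular[of _ "Suc q"]) (auto simp: M0_def)
  moreover have "prod_list (diag_mat M0) = x q"
  proof -
    have "diag_mat M0 = map (\<lambda>k. 1) [0..<q] @ [x q]"
      by (rule nth_equalityI) (auto simp: diag_mat_def M0_def nth_append less_Suc_eq)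
    then show ?thesis by (simp only: prod_list.append prod_list.Cons prod_list.Nil map_replicate_const prod_list_replicate) simp
  qed
  moreover have "x q = (Y * A' * Z) $$ (i, j)"
    using triple_product_entry[OF Y(1) A' Z(1) i j] by (simp add: x_def F_def)
  ultimately show "(Y * A' * Z) $$ (i, j) = 0\<^sub>m s t $$ (i, j)" using i j by simp
qed (use Y Z in auto)

text \<open>
  Apply the compression lemma to the complementary projections \<open>Y = 1 - L * K\<close> and
  \<open>Z = 1 - S * R\<close> and expand \<open>Y * A' * Z = 0\<close>; the second summand has \<open>W = Y * A' * S\<close>.
\<close>
lemma bounded_rank_tangent_decomposition:
  fixes A :: "real \<Rightarrow> complex mat"
  assumes eps: "\<epsilon> > 0"
    and A: "\<And>t. A t \<in> carrier_mat m n"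
    and rk: "\<And>t. t \<in> {-\<epsilon><..<\<epsilon>} \<Longrightarrow> mat_rank (A t) \<le> q"
    and deriv: "\<And>i j. i < m \<Longrightarrow> j < n \<Longrightarrow>
      ((\<lambda>t. A t $$ (i, j)) has_vector_derivative A' $$ (i, j)) (at 0)"
    and A': "A' \<in> carrier_mat m n"
    and L: "L \<in> carrier_mat m q" and R: "R \<in> carrier_mat q n" and A0: "A 0 = L * R"
    and K: "K \<in> carrier_mat q m" "K * L = 1\<^sub>m q" and rk0: "mat_rank (A 0) = q"
  obtains W where "W \<in> carrier_mat m q" "A' = L * (K * A') + W * R" "K * W = 0\<^sub>m q q"
proof -
  obtain S where S: "S \<in> carrier_mat n q" "R * S = 1\<^sub>m q"
    using factor_right_inverse[OF L R] A0 rk0 by metis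
  define Y where "Y = 1\<^sub>m m - L * K"
  define Z where "Z = 1\<^sub>m n - S * R"
  have Y: "Y \<in> carrier_mat m m" and Z: "Z \<in> carrier_mat n n"
    using L K(1) S(1) R by (auto simp: Y_def Z_def)
  have YL: "Y * L = 0\<^sub>m m q" unfolding Y_def
    using L K by (simp add: minus_mult_distrib_mat[of _ m m] assoc_mult_mat[OF L K(1) L])
  have KY: "K * Y = 0\<^sub>m q m" unfolding Y_def
    using L K by (simp add: mult_minus_distrib_mat[of _ q m _ m] assoc_mult_mat[OF K(1) L K(1), symmetric])
  have RZ: "R * Z = 0\<^sub>m q n" unfolding Z_def
    using R S by (simp add: mult_minus_distrib_mat[of _ q n _ n] assoc_mult_mat[OF R S(1) R, symmetric])
  have YA: "Y * A' \<in> carrier_mat m n" using Y A' by simp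
  define W where "W = Y * A' * S"
  have W: "W \<in> carrier_mat m q" using YA S by (simp add: W_def)
  have "Y * A' * Z = 0\<^sub>m m n"
    by (rule bounded_rank_tangent_compression[OF eps A rk deriv A' L R A0 K S Y YL Z RZ])
  moreover have "Y * A' * Z = Y * A' - W * R"
    using mult_minus_distrib_mat[OF YA one_carrier_mat mult_carrier_mat[OF S(1) R]]
      right_mult_one_mat[OF YA] assoc_mult_mat[OF YA S(1) R] by (simp only: Z_def W_def)
  ultimately have "Y * A' - W * R = 0\<^sub>m m n" by simp
  moreover have "Y * A' = A' - L * (K * A')"
    using A' L K(1) by (simp add: Y_def minus_mult_distrib_mat[of _ m m] assoc_mult_mat[OF L K(1) A'])
  ultimately have e: "A' - L * (K * A') - W * R = 0\<^sub>m m n" by simp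
  have "A' = L * (K * A') + W * R"
  proof (rule eq_matI)
    fix i j assume "i < dim_row (L * (K * A') + W * R)" "j < dim_col (L * (K * A') + W * R)"
    then have ij: "i < m" "j < n" using W R by auto
    have "(A' - L * (K * A') - W * R) $$ (i, j) = 0" using e ij by simp
    then show "A' $$ (i, j) = (L * (K * A') + W * R) $$ (i, j)"
      using ij W R L K A' by (simp add: diff_eq_eq add.commute del: index_mult_mat(1))
  qed (use A' W R in auto)
  moreover have "K * W = 0\<^sub>m q q"
  proof -
    have "K * W = K * (Y * A') * S" using assoc_mult_mat[OF K(1) YA S(1)] by (simp add: W_def)
    also have "K * (Y * A') = 0\<^sub>m q n" using assoc_mult_mat[OF K(1) Y A'] KY A' by simp
    finally show ?thesis using S by simp
  qed
  ultimately show ?thesis using that W by blast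
qed

section \<open>Multi-indices and mixed radix numbering\<close>

text \<open>
  By induction on \<open>j\<close>, the first \<open>j\<close> digits determine the number modulo the product of the first \<open>j\<close>
  bases.
\<close>
lemma mixed_radix_digits_inj:
  fixes n :: "nat \<Rightarrow> nat"
  assumes "p < (\<Prod>l\<in>{k+1..k+m}. n l)" and "p' < (\<Prod>l\<in>{k+1..k+m}. n l)"
    and "\<And>j. j \<in> {k+1..k+m} \<Longrightarrow>
      (p div (\<Prod>l\<in>{k+1..<j}. n l)) mod n j = (p' div (\<Prod>l\<in>{k+1..<j}. n l)) mod n j"
  shows "p = p'"
proof -
  have "p mod (\<Prod>l\<in>{k+1..<k+1+j}. n l) = p' mod (\<Prod>l\<in>{k+1..<k+1+j}. n l)" if "j \<le> m" for j
    using that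
  proof (induction j)
    case (Suc j)
    have *: "x mod (\<Prod>l\<in>{k+1..<k+1+Suc j}. n l) = (\<Prod>l\<in>{k+1..<k+1+j}. n l) * (x div (\<Prod>l\<in>{k+1..<k+1+j}. n l) mod n (k+1+j))
      + x mod (\<Prod>l\<in>{k+1..<k+1+j}. n l)" for x
    proof -
      have "(\<Prod>l\<in>{k+1..<k+1+Suc j}. n l) = (\<Prod>l\<in>{k+1..<k+1+j}. n l) * n (k+1+j)" by simp
      then show ?thesis by (simp only: mod_mult2_eq)
    qed
    show ?case unfolding * using Suc assms(3)[of "k+1+j"] by simp
  qed simp
  from this[of m] have "p mod (\<Prod>l\<in>{k+1..k+m}. n l) = p' mod (\<Prod>l\<in>{k+1..k+m}. n l)"
    by (simp add: atLeastLessThanSuc_atLeastAtMost)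
  then show ?thesis using assms(1,2) by simp
qed

text \<open>
  An injection between finite sets of equal cardinality is a bijection, so no inverse has to be
  written down.
\<close>
lemma mixed_radix_digits_bij:
  fixes n :: "nat \<Rightarrow> nat"
  shows "bij_betw (\<lambda>p. \<lambda>j\<in>{k+1..k+m}. (p div (\<Prod>l\<in>{k+1..<j}. n l)) mod n j)
    {..<\<Prod>l\<in>{k+1..k+m}. n l} (\<Pi>\<^sub>E j\<in>{k+1..k+m}. {..<n j})"
    (is "bij_betw ?f ?N ?P")
proof -
  have inj: "inj_on ?f ?N"
  proof (rule inj_onI)
    fix p p' assume p: "p \<in> ?N" "p' \<in> ?N" and eq: "?f p = ?f p'"
    show "p = p'"
    proof (rule mixed_radix_digits_inj[where k = k and m = m and n = n])
      fix j assume "j \<in> {k+1..k+m}"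
      then show "(p div (\<Prod>l\<in>{k+1..<j}. n l)) mod n j = (p' div (\<Prod>l\<in>{k+1..<j}. n l)) mod n j"
        using fun_cong[OF eq, of j] by simp
    qed (use p in auto)
  qed
  have "?f ` ?N \<subseteq> ?P"
  proof (rule image_subsetI)
    fix p assume "p \<in> ?N"
    then have "(\<Prod>l\<in>{k+1..k+m}. n l) \<noteq> 0" by (metis lessThan_iff less_nat_zero_code)
    then have "\<forall>l\<in>{k+1..k+m}. n l > 0" by (simp add: prod_zero_iff)
    then show "?f p \<in> ?P" by auto
  qed
  moreover have "card ?P = card (?f ` ?N)" using inj by (simp add: card_image card_PiE)
  moreover have "finite ?P" by (simp add: finite_PiE)
  ultimately have "?f ` ?N = ?P" by (intro card_subset_eq) simp_all
  then show ?thesis using inj by (simp add: bij_betw_def)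
qed

definition prefix_index :: "(nat \<Rightarrow> nat) \<Rightarrow> nat \<Rightarrow> nat \<Rightarrow> nat \<Rightarrow> nat" where
  "prefix_index n k p = (\<lambda>j\<in>{1..k}. (p div (\<Prod>l\<in>{1..<j}. n l)) mod n j)"

text \<open>
  The columns of an unfolding of \<open>V\<close> are its fibres along the first \<open>k\<close> modes; splicing allows
  summing over such a fibre while the later entries of a multi-index \<open>i\<close> stay in place.
\<close>
definition splice :: "nat \<Rightarrow> (nat \<Rightarrow> nat) \<Rightarrow> (nat \<Rightarrow> nat) \<Rightarrow> nat \<Rightarrow> nat" where
  "splice k p i = (\<lambda>j. if j \<in> {1..k} then p j else i j)"

lemma prefix_index_bij: "bij_betw (prefix_index n k) {..<\<Prod>l\<in>{1..k}. n l} (indices k n)"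
  using mixed_radix_digits_bij[where k = 0 and m = k and n = n] unfolding prefix_index_def indices_def by simp

lemma sum_prefix_index:
  "(\<Sum>p<(\<Prod>l\<in>{1..k}. n l). f (prefix_index n k p)) = sum f (indices k n)"
  by (rule sum.reindex_bij_betw[OF prefix_index_bij])

lemma split_index_prefix:
  assumes "k \<le> d" "j \<in> {1..k}" shows "split_index d n k p q j = prefix_index n k p j"
  using assms by (simp add: split_index_def prefix_index_def)

lemma split_index_splice:
  assumes "k \<le> d" shows "split_index d n k p q = splice k (prefix_index n k p) (split_index d n k p' q)"
  using assms by (auto simp: splice_def split_index_def prefix_index_def fun_eq_iff)

lemma split_index_indices:
  assumes k: "k \<le> d" and p: "p < (\<Prod>l\<in>{1..k}. n l)" and q: "q < (\<Prod>l\<in>{k+1..d}. n l)"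
  shows "split_index d n k p q \<in> indices d n"
proof -
  have "(\<Prod>l\<in>{1..k}. n l) \<noteq> 0" "(\<Prod>l\<in>{k+1..d}. n l) \<noteq> 0"
    by (rule gr_implies_not0[OF p], rule gr_implies_not0[OF q])
  then have "\<forall>l\<in>{1..k}. n l > 0" "\<forall>l\<in>{k+1..d}. n l > 0" by (simp_all add: prod_zero_iff)
  then have "\<forall>l\<in>{1..d}. n l > 0" by (metis Suc_eq_plus1 atLeastAtMost_iff not_less_eq_eq)
  then show ?thesis by (auto simp: split_index_def indices_def)
qed

lemma split_index_surj:
  assumes k: "k \<le> d" and i: "i \<in> indices d n"
  obtains p q where "p < (\<Prod>l\<in>{1..k}. n l)" "q < (\<Prod>l\<in>{k+1..d}. n l)" "i = split_index d n k p q"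
proof -
  have "restrict i {1..k} \<in> (\<Pi>\<^sub>E j\<in>{0+1..0+k}. {..<n j})" using i k by (auto simp: indices_def)
  then obtain p where p0: "p < (\<Prod>l\<in>{1..k}. n l)"
    and p: "restrict i {1..k} = (\<lambda>j\<in>{1..k}. (p div (\<Prod>l\<in>{1..<j}. n l)) mod n j)"
    unfolding bij_betw_imp_surj_on[OF mixed_radix_digits_bij[where k = 0 and m = k and n = n], symmetric]
    by (elim imageE) simp
  have "restrict i {k+1..d} \<in> (\<Pi>\<^sub>E j\<in>{k+1..k+(d-k)}. {..<n j})" using i k by (auto simp: indices_def)
  then obtain q where q0: "q < (\<Prod>l\<in>{k+1..d}. n l)"
    and q: "restrict i {k+1..d} = (\<lambda>j\<in>{k+1..d}. (q div (\<Prod>l\<in>{k+1..<j}. n l)) mod n j)"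
    unfolding bij_betw_imp_surj_on[OF mixed_radix_digits_bij[where k = k and m = "d - k" and n = n], symmetric]
    using k by (elim imageE) simp
  have "i = split_index d n k p q"
  proof
    fix j
    consider "j \<in> {1..k}" | "j \<in> {k+1..d}" | "j \<notin> {1..d}" using k by fastforce
    then show "i j = split_index d n k p q j"
    proof cases
      case 1 then show ?thesis using fun_cong[OF p, of j] k by (simp add: split_index_def)
    next
      case 2 then show ?thesis using fun_cong[OF q, of j] k by (simp add: split_index_def)
    next
      case 3 then show ?thesis using i by (auto simp: split_index_def indices_def)
    qed
  qed
  then show ?thesis using that p0 q0 by blast
qed

lemma sum_indices_Suc:
  fixes f :: "(nat \<Rightarrow> nat) \<Rightarrow> 'a :: comm_monoid_add"
  shows "sum f (indices (Suc k) n) = (\<Sum>p\<in>indices k n. \<Sum>x<n (Suc k). f (p(Suc k := x)))"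
proof -
  have "(\<Sum>p\<in>indices k n. \<Sum>x<n (Suc k). f (p(Suc k := x)))
      = sum (\<lambda>(p, x). f (p(Suc k := x))) (indices k n \<times> {..<n (Suc k)})"
    by (simp add: sum.cartesian_product)
  also have "\<dots> = sum f (indices (Suc k) n)"
  by (rule sum.reindex_bij_witness[of _ "\<lambda>i. (i(Suc k := undefined), i (Suc k))" "\<lambda>(p, x). p(Suc k := x)"])
       (auto simp: indices_def PiE_iff extensional_def fun_eq_iff)
  finally show ?thesis by simp
qed

lemma indices_less: "i \<in> indices d n \<Longrightarrow> j \<in> {1..d} \<Longrightarrow> i j < n j"
  by (auto simp: indices_def)

lemma splice_indices: "k \<le> d \<Longrightarrow> p \<in> indices k n \<Longrightarrow> i \<in> indices d n \<Longrightarrow> splice k p i \<in> indices d n"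
  by (auto simp: splice_def indices_def PiE_iff extensional_def)

lemma splice_restrict:
  assumes "p \<in> indices k n" shows "restrict (splice k p i) {1..Suc k} = p(Suc k := i (Suc k))"
  using assms by (auto simp: splice_def indices_def PiE_iff extensional_def fun_eq_iff le_Suc_eq)

section \<open>Interfaces of a tensor train\<close>

text \<open>
  The product of the \<open>m\<close> slices with numbers \<open>k, \<dots>, k + m - 1\<close>. The empty product has size 1, the
  value of \<open>r d\<close>, as the right interfaces always run up to the last core.
\<close>
primrec tail_prod :: "(nat \<Rightarrow> core) \<Rightarrow> (nat \<Rightarrow> nat) \<Rightarrow> nat \<Rightarrow> nat \<Rightarrow> complex mat" where
  "tail_prod U i k 0 = 1\<^sub>m 1"
| "tail_prod U i k (Suc m) = U k (i k) * tail_prod U i (Suc k) m"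

definition right_interface :: "nat \<Rightarrow> (nat \<Rightarrow> core) \<Rightarrow> (nat \<Rightarrow> nat) \<Rightarrow> nat \<Rightarrow> complex mat" where
  "right_interface d U i k = tail_prod U i (Suc k) (d - k)"

lemma right_interface_last [simp]: "right_interface d U i d = 1\<^sub>m 1"
  by (simp add: right_interface_def)

lemma right_interface_step:
  "k < d \<Longrightarrow> right_interface d U i k = U (Suc k) (i (Suc k)) * right_interface d U i (Suc k)"
  by (simp add: right_interface_def Suc_diff_Suc[symmetric])

lemma core_prod_cong:
  "(\<And>j. j \<in> {1..k} \<Longrightarrow> U j (i j) = U' j (i' j)) \<Longrightarrow> core_prod U i k = core_prod U' i' k"
  by (induction k) auto

lemma right_interface_cong:
  assumes "k \<le> d" "\<And>j. j \<in> {k+1..d} \<Longrightarrow> U j (i j) = U' j (i' j)"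
  shows "right_interface d U i k = right_interface d U' i' k"
  using assms by (induction rule: inc_induct) (auto simp: right_interface_step)

lemma tt_cong:
  assumes "\<And>k x. k \<in> {1..d} \<Longrightarrow> x < n k \<Longrightarrow> U k x = U' k x"
  shows "tt d n U = tt d n U'"
  unfolding tt_def using core_prod_cong[of d U _ U'] assms indices_less by (intro ext) auto

lemma core_carrier:
  assumes "are_cores d n r U" "k < d" "i (Suc k) < n (Suc k)"
  shows "U (Suc k) (i (Suc k)) \<in> carrier_mat (r k) (r (Suc k))"
  using assms by (force simp: are_cores_def is_core_def)

lemma core_prod_carrier:
  assumes "are_cores d n r U" "r 0 = 1" "k \<le> d" "i \<in> indices k n"
  shows "core_prod U i k \<in> carrier_mat 1 (r k)"
proof -
  have "core_prod U i j \<in> carrier_mat 1 (r j)" if "j \<le> k" for j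
    using that
  proof (induction j)
    case (Suc j)
    then show ?case
      using core_carrier[OF assms(1), of j i] indices_less[OF assms(4), of "Suc j"] assms(3)
        mult_carrier_mat[of "core_prod U i j" 1 "r j"] by simp
  qed (simp add: assms)
  then show ?thesis by simp
qed

lemma core_prod_carrier_full:
  assumes "are_cores d n r U" "r 0 = 1" "k \<le> d" "i \<in> indices d n"
  shows "core_prod U i k \<in> carrier_mat 1 (r k)"
proof -
  have "core_prod U i k = core_prod U (restrict i {1..k}) k" by (rule core_prod_cong) simp
  moreover have "restrict i {1..k} \<in> indices k n" using assms(3,4) by (auto simp: indices_def)
  ultimately show ?thesis using core_prod_carrier[OF assms(1-3)] by simp
qed

lemma right_interface_carrier:
  assumes U: "are_cores d n r U" and r: "r d = 1" and i: "i \<in> indices d n" and k: "k \<le> d"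
  shows "right_interface d U i k \<in> carrier_mat (r k) 1"
  using k
proof (induction rule: inc_induct)
  case (step k)
  then show ?case
    using core_carrier[OF U, of k i] indices_less[OF i, of "Suc k"]
    by (auto simp: right_interface_step intro!: mult_carrier_mat)
qed (simp add: r)

text \<open>
  Downward induction on \<open>k\<close> moves one slice after another across the multiplication sign.
\<close>
lemma core_prod_split:
  assumes U: "are_cores d n r U" and r: "r 0 = 1" "r d = 1" and i: "i \<in> indices d n" and k: "k \<le> d"
  shows "core_prod U i d = core_prod U i k * right_interface d U i k"
  using k
proof (induction rule: inc_induct)
  case base
  show ?case using core_prod_carrier_full[OF U r(1) _ i, of d] r by simp
next
  case (step k)
  have "core_prod U i k * right_interface d U i k
      = core_prod U i k * (U (Suc k) (i (Suc k)) * right_interface d U i (Suc k))"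
    using step by (simp add: right_interface_step)
  also have "\<dots> = core_prod U i (Suc k) * right_interface d U i (Suc k)"
    using assoc_mult_mat[OF core_prod_carrier_full[OF U r(1) _ i, of k]
        core_carrier[OF U, of k i] right_interface_carrier[OF U r(2) i, of "Suc k"]]
      step indices_less[OF i, of "Suc k"] by simp
  finally show ?case using step by simp
qed

lemma core_prod_Suc_entry:
  assumes U: "are_cores d n r U" and r: "r 0 = 1" and k: "k < d" and p: "p \<in> indices k n"
    and x: "x < n (Suc k)" and b: "b < r (Suc k)"
  shows "core_prod U (p(Suc k := x)) (Suc k) $$ (0, b)
    = (\<Sum>a<r k. core_prod U p k $$ (0, a) * U (Suc k) x $$ (a, b))"
proof -
  have "core_prod U (p(Suc k := x)) k = core_prod U p k" by (rule core_prod_cong) simp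
  then show ?thesis
    using core_prod_carrier[OF U r _ p] core_carrier[OF U k, of "p(Suc k := x)"] k x b
    by (auto simp: scalar_prod_def atLeast0LessThan intro!: sum.cong)
qed

lemma core_prod_Suc_entry_full:
  assumes U: "are_cores d n r U" and r: "r 0 = 1" and k: "k < d" and i: "i \<in> indices d n" and b: "b < r (Suc k)"
  shows "core_prod U i (Suc k) $$ (0, b)
    = (\<Sum>a<r k. core_prod U i k $$ (0, a) * U (Suc k) (i (Suc k)) $$ (a, b))"
  using core_prod_carrier_full[OF U r _ i, of k] core_carrier[OF U k, of i] indices_less[OF i, of "Suc k"] k b
  by (auto simp: scalar_prod_def atLeast0LessThan intro!: sum.cong)

lemma tt_entry:
  assumes U: "are_cores d n r U" and r: "r 0 = 1" "r d = 1" and i: "i \<in> indices d n" and k: "k \<le> d"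
  shows "tt d n U i = (\<Sum>b<r k. core_prod U i k $$ (0, b) * right_interface d U i k $$ (b, 0))"
  using core_prod_split[OF U r i k] core_prod_carrier_full[OF U r(1) k i] right_interface_carrier[OF U r(2) i k] i
  by (auto simp: tt_def scalar_prod_def atLeast0LessThan intro!: sum.cong)

lemma are_cores_upd: "are_cores d n r U \<Longrightarrow> are_cores d n r D \<Longrightarrow> are_cores d n r (U(k := D k))"
  by (auto simp: are_cores_def)

text \<open>
  Replacing one core leaves the left interface before it and the right interface after it unchanged,
  so each term of the tangent form is linear in the variation with these interfaces as coefficients.
\<close>
lemma tt_upd_entry:
  assumes U: "are_cores d n r U" and D: "are_cores d n r D" and r: "r 0 = 1" "r d = 1"
    and i: "i \<in> indices d n" and k: "k < d"
  shows "tt d n (U(Suc k := D (Suc k))) i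
    = (\<Sum>a<r k. \<Sum>b<r (Suc k). core_prod U i k $$ (0, a) * D (Suc k) (i (Suc k)) $$ (a, b)
        * right_interface d U i (Suc k) $$ (b, 0))"
proof -
  let ?U = "U(Suc k := D (Suc k))"
  have c: "are_cores d n r ?U" using are_cores_upd[OF U D] .
  have e1: "core_prod ?U i k = core_prod U i k" by (rule core_prod_cong) auto
  have e2: "right_interface d ?U i (Suc k) = right_interface d U i (Suc k)"
    by (rule right_interface_cong) (use k in auto)
  have "tt d n ?U i = (\<Sum>b<r (Suc k). (\<Sum>a<r k. core_prod U i k $$ (0, a) * D (Suc k) (i (Suc k)) $$ (a, b))
      * right_interface d U i (Suc k) $$ (b, 0))"
    using tt_entry[OF c r i, of "Suc k"] k e1 e2 core_prod_carrier_full[OF U r(1) _ i, of k]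
      core_carrier[OF D k, of i] indices_less[OF i, of "Suc k"]
    by (auto simp: scalar_prod_def atLeast0LessThan intro!: sum.cong)
  also have "\<dots> = (\<Sum>b<r (Suc k). \<Sum>a<r k. core_prod U i k $$ (0, a) * D (Suc k) (i (Suc k)) $$ (a, b)
        * right_interface d U i (Suc k) $$ (b, 0))"
    by (simp add: sum_distrib_right)
  also have "\<dots> = (\<Sum>a<r k. \<Sum>b<r (Suc k). core_prod U i k $$ (0, a) * D (Suc k) (i (Suc k)) $$ (a, b)
        * right_interface d U i (Suc k) $$ (b, 0))"
    by (rule sum.swap)
  finally show ?thesis .
qed

section \<open>Gram matrices of left interfaces\<close>

lemma mat_adjoint_entry:
  fixes A :: "complex mat"
  assumes "a < dim_col A" "b < dim_row A"
  shows "mat_adjoint A $$ (a, b) = cnj (A $$ (b, a))"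
  using assms by (simp add: mat_adjoint_def mat_of_rows_index)

lemma mat_adjoint_dims [simp]:
  "dim_row (mat_adjoint A) = dim_col A" "dim_col (mat_adjoint A) = dim_row A"
  by (simp_all add: mat_adjoint_def)

text \<open>
  The row index of the left unfolding is \<open>s = x * p + a\<close> with slice number \<open>x\<close> and row \<open>a\<close> of the
  slice, so the sum over \<open>s\<close> splits into blocks of length \<open>p\<close>.
\<close>
lemma left_unfolding_gram:
  assumes p: "p > 0" and b: "b < q" "b' < q"
  shows "(mat_adjoint (left_unfolding p m q C) * left_unfolding p m q D) $$ (b, b')
    = (\<Sum>x<m. \<Sum>a<p. cnj (C x $$ (a, b)) * D x $$ (a, b'))"
proof -
  have "(mat_adjoint (left_unfolding p m q C) * left_unfolding p m q D) $$ (b, b')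
      = (\<Sum>s<m * p. cnj (C (s div p) $$ (s mod p, b)) * D (s div p) $$ (s mod p, b'))"
    using b by (auto simp: scalar_prod_def atLeast0LessThan mat_adjoint_entry left_unfolding_def mult.commute
        intro!: sum.cong)
  also have "\<dots> = (\<Sum>x<m. \<Sum>s\<in>{x * p..<x * p + p}. cnj (C (s div p) $$ (s mod p, b)) * D (s div p) $$ (s mod p, b'))"
    by (rule sum.nat_group[symmetric])
  also have "\<dots> = (\<Sum>x<m. \<Sum>a<p. cnj (C x $$ (a, b)) * D x $$ (a, b'))"
  proof (rule sum.cong[OF refl])
    fix x
    show "(\<Sum>s\<in>{x * p..<x * p + p}. cnj (C (s div p) $$ (s mod p, b)) * D (s div p) $$ (s mod p, b'))
        = (\<Sum>a<p. cnj (C x $$ (a, b)) * D x $$ (a, b'))"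
      using p by (subst sum.atLeastLessThan_shift_0) (simp add: atLeast0LessThan)
  qed
  finally show ?thesis .
qed

text \<open>
  For core families \<open>U\<close> and \<open>V\<close> this is the product of the adjoint of the \<open>k\<close>-th left interface of
  \<open>U\<close> with that of \<open>V\<close>. Allowing two families lets orthonormality, the gauge conditions and
  tensor inner products be treated by one recursion in \<open>k\<close>.
\<close>
definition prefix_gram where
  "prefix_gram n U V k b b' = (\<Sum>i\<in>indices k n. cnj (core_prod U i k $$ (0, b)) * core_prod V i k $$ (0, b'))"

lemma prefix_gram_Suc:
  assumes U: "are_cores d n r U" and V: "are_cores d n r V" and r: "r 0 = 1" and k: "k < d"
    and b: "b < r (Suc k)" "b' < r (Suc k)"
  shows "prefix_gram n U V (Suc k) b b' = (\<Sum>x<n (Suc k). \<Sum>a<r k. \<Sum>a'<r k.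
    cnj (U (Suc k) x $$ (a, b)) * V (Suc k) x $$ (a', b') * prefix_gram n U V k a a')"
proof -
  have "prefix_gram n U V (Suc k) b b' = (\<Sum>p\<in>indices k n. \<Sum>x<n (Suc k).
      cnj (\<Sum>a<r k. core_prod U p k $$ (0, a) * U (Suc k) x $$ (a, b))
      * (\<Sum>a'<r k. core_prod V p k $$ (0, a') * V (Suc k) x $$ (a', b')))"
    unfolding prefix_gram_def sum_indices_Suc
    by (intro sum.cong refl) (simp only: core_prod_Suc_entry[OF U r k _ _ b(1)] core_prod_Suc_entry[OF V r k _ _ b(2)] lessThan_iff)
  also have "\<dots> = (\<Sum>p\<in>indices k n. \<Sum>x<n (Suc k). \<Sum>a<r k. \<Sum>a'<r k.
      cnj (U (Suc k) x $$ (a, b)) * V (Suc k) x $$ (a', b') * (cnj (core_prod U p k $$ (0, a)) * core_prod V p k $$ (0, a')))"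
    unfolding cnj_sum sum_product by (intro sum.cong refl) (simp add: ac_simps)
  also have "\<dots> = (\<Sum>x<n (Suc k). \<Sum>p\<in>indices k n. \<Sum>a<r k. \<Sum>a'<r k.
      cnj (U (Suc k) x $$ (a, b)) * V (Suc k) x $$ (a', b') * (cnj (core_prod U p k $$ (0, a)) * core_prod V p k $$ (0, a')))"
    by (rule sum.swap)
  also have "\<dots> = (\<Sum>x<n (Suc k). \<Sum>a<r k. \<Sum>a'<r k. \<Sum>p\<in>indices k n.
      cnj (U (Suc k) x $$ (a, b)) * V (Suc k) x $$ (a', b') * (cnj (core_prod U p k $$ (0, a)) * core_prod V p k $$ (0, a')))"
    by (intro sum.cong refl trans[OF sum.swap] sum.swap)
  finally show ?thesis by (simp add: prefix_gram_def sum_distrib_left)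
qed

text \<open>
  If the Gram matrix at \<open>k\<close> is the identity, the recursion gives at \<open>k + 1\<close> the Gram matrix of the left
  unfolding of the next core, which is the identity by left-orthogonality.
\<close>
lemma prefix_gram_orthonormal:
  assumes U: "are_cores d n r U" and lo: "left_orthogonal d n r U" and r: "r 0 = 1" and rpos: "\<forall>k\<le>d. r k > 0"
    and k: "k < d" and b: "b < r k" "b' < r k"
  shows "prefix_gram n U U k b b' = (if b = b' then 1 else 0)"
  using k b
proof (induction k arbitrary: b b')
  case 0
  then show ?case using r by (simp add: prefix_gram_def indices_def)
next
  case (Suc k)
  have "prefix_gram n U U (Suc k) b b' = (\<Sum>x<n (Suc k). \<Sum>a<r k. \<Sum>a'<r k.
    cnj (U (Suc k) x $$ (a, b)) * U (Suc k) x $$ (a', b') * (if a = a' then 1 else 0))"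
    unfolding prefix_gram_Suc[OF U U r Suc_lessD[OF Suc.prems(1)] Suc.prems(2,3)]
    by (intro sum.cong refl) (use Suc in auto)
  also have "\<dots> = (\<Sum>x<n (Suc k). \<Sum>a<r k. cnj (U (Suc k) x $$ (a, b)) * U (Suc k) x $$ (a, b'))"
    by (simp add: if_distrib cong: if_cong)
  also have "\<dots> = (mat_adjoint (left_unfolding (r k) (n (Suc k)) (r (Suc k)) (U (Suc k)))
       * left_unfolding (r k) (n (Suc k)) (r (Suc k)) (U (Suc k))) $$ (b, b')"
    using left_unfolding_gram[OF _ Suc.prems(2,3)] rpos Suc.prems(1) by simp
  also have "\<dots> = (1\<^sub>m (r (Suc k)) :: complex mat) $$ (b, b')"
    using bspec[OF lo[unfolded left_orthogonal_def], of "Suc k"] Suc.prems(1) by simp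
  finally show ?case using Suc.prems by simp
qed

text \<open>
  At the varied core the recursion reduces to the gauge condition, since the interfaces before
  it are orthonormal. Afterwards both families share the same cores, and the recursion
  carries the zero matrix along.
\<close>
lemma prefix_gram_gauge:
  assumes U: "are_cores d n r U" and D: "are_cores d n r D" and lo: "left_orthogonal d n r U"
    and r: "r 0 = 1" and rpos: "\<forall>k\<le>d. r k > 0" and k: "Suc k < d"
    and gauge: "mat_adjoint (left_unfolding (r k) (n (Suc k)) (r (Suc k)) (D (Suc k)))
            * left_unfolding (r k) (n (Suc k)) (r (Suc k)) (U (Suc k)) = 0\<^sub>m (r (Suc k)) (r (Suc k))"
    and j: "Suc k \<le> j" "j \<le> d" and b: "b < r j" "b' < r j"
  shows "prefix_gram n (U(Suc k := D (Suc k))) U j b b' = 0"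
  using j b
proof (induction j arbitrary: b b' rule: dec_induct)
  case base
  have c: "are_cores d n r (U(Suc k := D (Suc k)))" by (rule are_cores_upd[OF U D])
  have "core_prod (U(Suc k := D (Suc k))) i k = core_prod U i k" for i by (rule core_prod_cong) auto
  then have e: "prefix_gram n (U(Suc k := D (Suc k))) U k = prefix_gram n U U k" by (simp add: prefix_gram_def fun_eq_iff)
  have "prefix_gram n (U(Suc k := D (Suc k))) U (Suc k) b b' = (\<Sum>x<n (Suc k). \<Sum>a<r k. \<Sum>a'<r k.
    cnj (D (Suc k) x $$ (a, b)) * U (Suc k) x $$ (a', b') * (if a = a' then 1 else 0))"
    unfolding prefix_gram_Suc[OF c U r Suc_lessD[OF k] base(2,3)] e
    by (intro sum.cong refl) (use prefix_gram_orthonormal[OF U lo r rpos Suc_lessD[OF k]] in auto)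
  also have "\<dots> = (\<Sum>x<n (Suc k). \<Sum>a<r k. cnj (D (Suc k) x $$ (a, b)) * U (Suc k) x $$ (a, b'))"
    by (simp add: if_distrib cong: if_cong)
  also have "\<dots> = 0"
    using left_unfolding_gram[of "r k", OF _ base(2,3), of "n (Suc k)" "D (Suc k)" "U (Suc k)"] gauge rpos k base by simp
  finally show ?case .
next
  case (step j)
  have c: "are_cores d n r (U(Suc k := D (Suc k)))" by (rule are_cores_upd[OF U D])
  have "j < d" using step by simp
  have "prefix_gram n (U(Suc k := D (Suc k))) U j a a' = 0" if "a < r j" "a' < r j" for a a'
    by (rule step.IH) (use that \<open>j < d\<close> in auto)
  then show ?case unfolding prefix_gram_Suc[OF c U r \<open>j < d\<close> step.prems(2,3)]
    by (intro sum.neutral ballI) auto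
qed

lemma prefix_gram_last:
  assumes U: "are_cores d n r U" and D: "are_cores d n r D" and lo: "left_orthogonal d n r U"
    and r: "r 0 = 1" "r d = 1" and rpos: "\<forall>k\<le>d. r k > 0" and d: "d > 0"
  shows "prefix_gram n (U(d := D d)) U d 0 0 = core_inner (r (d - 1)) (n d) (r d) (D d) (U d)"
proof -
  obtain k where k: "d = Suc k" using d by (cases d) auto
  have c: "are_cores d n r (U(d := D d))" by (rule are_cores_upd[OF U D])
  have "core_prod (U(Suc k := D (Suc k))) i k = core_prod U i k" for i by (rule core_prod_cong) auto
  then have e: "prefix_gram n (U(Suc k := D (Suc k))) U k = prefix_gram n U U k" by (simp add: prefix_gram_def fun_eq_iff)
  have "prefix_gram n (U(Suc k := D (Suc k))) U (Suc k) 0 0 = (\<Sum>x<n (Suc k). \<Sum>a<r k. \<Sum>a'<r k.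
    cnj (D (Suc k) x $$ (a, 0)) * U (Suc k) x $$ (a', 0) * (if a = a' then 1 else 0))"
    using prefix_gram_Suc[OF c U r(1), of k 0 0] k r(2) prefix_gram_orthonormal[OF U lo r(1) rpos, of k]
    by (auto simp: e intro!: sum.cong)
  also have "\<dots> = (\<Sum>x<n (Suc k). \<Sum>a<r k. cnj (D (Suc k) x $$ (a, 0)) * U (Suc k) x $$ (a, 0))"
    by (simp add: if_distrib cong: if_cong)
  also have "\<dots> = (\<Sum>a<r k. \<Sum>x<n (Suc k). cnj (D (Suc k) x $$ (a, 0)) * U (Suc k) x $$ (a, 0))"
    by (rule sum.swap)
  finally show ?thesis using r k by (simp add: core_inner_def)
qed

lemma tensor_inner_tt: "tensor_inner d n (tt d n U) (tt d n V) = prefix_gram n U V d 0 0"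
  by (simp add: tensor_inner_def prefix_gram_def tt_def)

text \<open>
  The inner product with \<open>X\<close> of each term of the tangent form is its last Gram matrix, which vanishes
  for all variations subject to a gauge condition.
\<close>
lemma tensor_inner_tangent:
  assumes U: "are_cores d n r U" and D: "are_cores d n r D" and lo: "left_orthogonal d n r U"
    and r: "r 0 = 1" "r d = 1" and rpos: "\<forall>k\<le>d. r k > 0" and d: "d > 0"
    and gauge: "\<forall>k\<in>{1..d-1}. mat_adjoint (left_unfolding (r (k - 1)) (n k) (r k) (D k))
            * left_unfolding (r (k - 1)) (n k) (r k) (U k) = 0\<^sub>m (r k) (r k)"
  shows "tensor_inner d n (\<lambda>i. \<Sum>k=1..d. tt d n (U(k := D k)) i) (tt d n U)
    = core_inner (r (d - 1)) (n d) (r d) (D d) (U d)"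
proof -
  have "tensor_inner d n (\<lambda>i. \<Sum>k=1..d. tt d n (U(k := D k)) i) (tt d n U)
      = (\<Sum>k=1..d. tensor_inner d n (tt d n (U(k := D k))) (tt d n U))"
    unfolding tensor_inner_def by (subst sum.swap) (simp add: sum_distrib_right)
  also have "\<dots> = (\<Sum>k\<in>insert d {1..d-1}. prefix_gram n (U(k := D k)) U d 0 0)"
    unfolding tensor_inner_tt using d by (intro sum.cong) auto
  also have "\<dots> = prefix_gram n (U(d := D d)) U d 0 0 + (\<Sum>k\<in>{1..d-1}. prefix_gram n (U(k := D k)) U d 0 0)"
    using d by (intro sum.insert) auto
  also have "(\<Sum>k\<in>{1..d-1}. prefix_gram n (U(k := D k)) U d 0 0) = 0"
  proof (rule sum.neutral, rule ballI)
    fix k assume k: "k \<in> {1..d-1}"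
    then obtain k' where k': "k = Suc k'" "Suc k' < d" by (cases k) auto
    show "prefix_gram n (U(k := D k)) U d 0 0 = 0"
      using prefix_gram_gauge[OF U D lo r(1) rpos k'(2), of d 0 0] gauge[rule_format, OF k] k' r by simp
  qed
  finally show ?thesis by (simp only: prefix_gram_last[OF U D lo r rpos d] add_0_right)
qed

section \<open>Unfoldings of a tensor train\<close>

lemma unfolding_mat_carrier:
  "unfolding_mat d n k X \<in> carrier_mat (\<Prod>l\<in>{1..k}. n l) (\<Prod>l\<in>{k+1..d}. n l)"
  by (simp add: unfolding_mat_def)

text \<open>
  The interfaces as matrices whose rows and columns are numbered like those of the unfoldings. For
  the right interface the row number 0 in the multi-index is arbitrary, because the product only
  sees the modes after \<open>k\<close>.
\<close>
definition left_interface_mat :: "(nat \<Rightarrow> nat) \<Rightarrow> (nat \<Rightarrow> nat) \<Rightarrow> (nat \<Rightarrow> core) \<Rightarrow> nat \<Rightarrow> complex mat" where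
  "left_interface_mat n r U k = mat (\<Prod>l\<in>{1..k}. n l) (r k) (\<lambda>(p, b). core_prod U (prefix_index n k p) k $$ (0, b))"

definition right_interface_mat :: "nat \<Rightarrow> (nat \<Rightarrow> nat) \<Rightarrow> (nat \<Rightarrow> nat) \<Rightarrow> (nat \<Rightarrow> core) \<Rightarrow> nat \<Rightarrow> complex mat" where
  "right_interface_mat d n r U k = mat (r k) (\<Prod>l\<in>{k+1..d}. n l)
     (\<lambda>(b, q). right_interface d U (split_index d n k 0 q) k $$ (b, 0))"

lemma core_prod_split_index:
  "k \<le> d \<Longrightarrow> core_prod U (split_index d n k p q) k = core_prod U (prefix_index n k p) k"
  by (rule core_prod_cong) (simp add: split_index_prefix)

lemma right_interface_split_index:
  "k \<le> d \<Longrightarrow> right_interface d U (split_index d n k p q) k = right_interface d U (split_index d n k 0 q) k"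
  by (rule right_interface_cong) (auto simp: split_index_def)

lemma unfolding_tt:
  assumes U: "are_cores d n r U" and r: "r 0 = 1" "r d = 1" and k: "k \<le> d"
  shows "unfolding_mat d n k (tt d n U) = left_interface_mat n r U k * right_interface_mat d n r U k"
proof (rule eq_matI)
  fix p q
  assume "p < dim_row (left_interface_mat n r U k * right_interface_mat d n r U k)"
    "q < dim_col (left_interface_mat n r U k * right_interface_mat d n r U k)"
  then have p: "p < (\<Prod>l\<in>{1..k}. n l)" and q: "q < (\<Prod>l\<in>{k+1..d}. n l)"
    by (simp_all add: left_interface_mat_def right_interface_mat_def)
  show "unfolding_mat d n k (tt d n U) $$ (p, q)
      = (left_interface_mat n r U k * right_interface_mat d n r U k) $$ (p, q)"
    using p q tt_entry[OF U r split_index_indices[OF k p q] k]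
      core_prod_split_index[OF k] right_interface_split_index[OF k, of U n p q]
    by (simp add: unfolding_mat_def left_interface_mat_def right_interface_mat_def scalar_prod_def atLeast0LessThan)
qed (simp_all add: unfolding_mat_def left_interface_mat_def right_interface_mat_def)

lemma left_interface_gram:
  assumes U: "are_cores d n r U" and lo: "left_orthogonal d n r U" and r: "r 0 = 1" and rpos: "\<forall>k\<le>d. r k > 0"
    and k: "k < d"
  shows "mat_adjoint (left_interface_mat n r U k) * left_interface_mat n r U k = 1\<^sub>m (r k)"
proof (rule eq_matI)
  fix b b' assume "b < dim_row (1\<^sub>m (r k) :: complex mat)" "b' < dim_col (1\<^sub>m (r k) :: complex mat)"
  then have b: "b < r k" "b' < r k" by auto
  have "(mat_adjoint (left_interface_mat n r U k) * left_interface_mat n r U k) $$ (b, b')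
      = (\<Sum>p<(\<Prod>l\<in>{1..k}. n l). cnj (core_prod U (prefix_index n k p) k $$ (0, b)) * core_prod U (prefix_index n k p) k $$ (0, b'))"
    using b by (auto simp: left_interface_mat_def scalar_prod_def mat_adjoint_entry atLeast0LessThan intro!: sum.cong)
  also have "\<dots> = prefix_gram n U U k b b'" unfolding prefix_gram_def by (rule sum_prefix_index)
  finally show "(mat_adjoint (left_interface_mat n r U k) * left_interface_mat n r U k) $$ (b, b')
      = 1\<^sub>m (r k) $$ (b, b')" using prefix_gram_orthonormal[OF U lo r rpos k b] b by simp
qed (simp_all add: left_interface_mat_def)

section \<open>Velocities have the tangent form\<close>

text \<open>
  Row \<open>b\<close> of \<open>C k = (L k)\<^sup>* V\<close>, read as a function of multi-indices. Only the
  entries of \<open>i\<close> after position \<open>k\<close> matter, but taking full multi-indices lets coefficients for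
  different \<open>k\<close> be compared without renumbering.
\<close>
definition left_coefficient where
  "left_coefficient n U k V b i = (\<Sum>p\<in>indices k n. cnj (core_prod U p k $$ (0, b)) * V (splice k p i))"

lemma left_coefficient_unfolding:
  assumes k: "k \<le> d" and b: "b < r k" and q: "q < (\<Prod>l\<in>{k+1..d}. n l)"
  shows "(mat_adjoint (left_interface_mat n r U k) * unfolding_mat d n k V) $$ (b, q)
    = left_coefficient n U k V b (split_index d n k p q)"
proof -
  have "(mat_adjoint (left_interface_mat n r U k) * unfolding_mat d n k V) $$ (b, q)
      = (\<Sum>p'<(\<Prod>l\<in>{1..k}. n l). cnj (core_prod U (prefix_index n k p') k $$ (0, b))
          * V (splice k (prefix_index n k p') (split_index d n k p q)))"
    using b q
    by (auto simp: left_interface_mat_def unfolding_mat_def scalar_prod_def mat_adjoint_entry atLeast0LessThan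
        split_index_splice[OF k, symmetric] intro!: sum.cong)
  also have "\<dots> = left_coefficient n U k V b (split_index d n k p q)"
    unfolding left_coefficient_def by (rule sum_prefix_index)
  finally show ?thesis .
qed

text \<open>
  The matrix decomposition of the velocity of an unfolding, translated back to multi-indices. The
  left inverse of the left interface is its adjoint, so the first summand is the orthogonal projection of
  \<open>V\<close> onto the column span of \<open>L k\<close>. The function \<open>w\<close> holds the rows of \<open>W\<close> and depends on the first \<open>k\<close> entries only.
\<close>
lemma tangent_unfolding_split:
  assumes U: "are_cores d n r U" and lo: "left_orthogonal d n r U" and r: "r 0 = 1" "r d = 1"
    and rpos: "\<forall>k\<le>d. r k > 0" and X: "tt d n U \<in> tt_manifold d n r"
    and V: "V \<in> tangent_space (tt_manifold d n r) (tt d n U)"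
    and k: "0 < k" "k < d"
  obtains w where
    "\<And>i. i \<in> indices d n \<Longrightarrow> V i = (\<Sum>b<r k. core_prod U i k $$ (0, b) * left_coefficient n U k V b i)
        + (\<Sum>b<r k. w (restrict i {1..k}) b * right_interface d U i k $$ (b, 0))"
    "\<And>b b'. b < r k \<Longrightarrow> b' < r k \<Longrightarrow> (\<Sum>p\<in>indices k n. cnj (w p b) * core_prod U p k $$ (0, b')) = 0"
proof -
  obtain \<gamma> \<gamma>' \<epsilon> where eps: "\<epsilon> > (0 :: real)" and g0: "\<gamma> 0 = tt d n U" "\<gamma>' 0 = V"
    and gM: "\<And>t. t \<in> {-\<epsilon><..<\<epsilon>} \<Longrightarrow> \<gamma> t \<in> tt_manifold d n r"
    and gd: "\<And>i t. t \<in> {-\<epsilon><..<\<epsilon>} \<Longrightarrow> ((\<lambda>s. \<gamma> s i) has_vector_derivative \<gamma>' t i) (at t)"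
    using V unfolding tangent_space_def by blast
  let ?N = "\<Prod>l\<in>{1..k}. n l" and ?N' = "\<Prod>l\<in>{k+1..d}. n l"
  let ?L = "left_interface_mat n r U k" and ?R = "right_interface_mat d n r U k"
  let ?A = "\<lambda>t. unfolding_mat d n k (\<gamma> t)"
  have kd: "k \<le> d" using k by simp
  have L: "?L \<in> carrier_mat ?N (r k)" and R: "?R \<in> carrier_mat (r k) ?N'"
    by (simp_all add: left_interface_mat_def right_interface_mat_def)
  have K: "mat_adjoint ?L \<in> carrier_mat (r k) ?N" using L by auto
  have rank: "mat_rank (?A t) = r k" if "t \<in> {-\<epsilon><..<\<epsilon>}" for t
    using gM[OF that] k unfolding tt_manifold_def tt_rank_def by (auto dest: spec[of _ k])
  have deriv: "((\<lambda>t. ?A t $$ (p, q)) has_vector_derivative unfolding_mat d n k V $$ (p, q)) (at 0)"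
    if "p < ?N" "q < ?N'" for p q
    using gd[of 0 "split_index d n k p q"] eps that g0 by (simp add: unfolding_mat_def)
  obtain W where W: "W \<in> carrier_mat ?N (r k)"
    and dec: "unfolding_mat d n k V = ?L * (mat_adjoint ?L * unfolding_mat d n k V) + W * ?R"
    and KW: "mat_adjoint ?L * W = 0\<^sub>m (r k) (r k)"
  proof (rule bounded_rank_tangent_decomposition[OF eps unfolding_mat_carrier _ deriv unfolding_mat_carrier L R _ K])
    show "mat_rank (?A t) \<le> r k" if "t \<in> {-\<epsilon><..<\<epsilon>}" for t using rank[OF that] by simp
    show "?A 0 = ?L * ?R" using unfolding_tt[OF U r kd] g0 by simp
    show "mat_adjoint ?L * ?L = 1\<^sub>m (r k)" using left_interface_gram[OF U lo r(1) rpos k(2)] .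
    show "mat_rank (?A 0) = r k" using rank[of 0] eps by simp
  qed blast
  define w where "w \<pi> b = W $$ (the_inv_into {..<?N} (prefix_index n k) \<pi>, b)" for \<pi> b
  have w: "w (prefix_index n k p) b = W $$ (p, b)" if "p < ?N" for p b
    using that the_inv_into_f_f[OF bij_betw_imp_inj_on[OF prefix_index_bij]] by (simp add: w_def)
  show ?thesis
  proof (rule that)
    fix i assume "i \<in> indices d n"
    then obtain p q where p: "p < ?N" and q: "q < ?N'" and i: "i = split_index d n k p q"
      using split_index_surj[OF kd] by metis
    have pr: "restrict i {1..k} = prefix_index n k p"
      using i split_index_prefix[OF kd] by (auto simp: fun_eq_iff prefix_index_def)
    have "V i = unfolding_mat d n k V $$ (p, q)" using p q i by (simp add: unfolding_mat_def)
    also have "\<dots> = (?L * (mat_adjoint ?L * unfolding_mat d n k V)) $$ (p, q) + (W * ?R) $$ (p, q)"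
      using dec p q L R W K unfolding_mat_carrier[of d n k V] 
      by (metis (no_types, lifting) carrier_matD index_add_mat(1) index_mult_mat(2,3))
    also have "(W * ?R) $$ (p, q) = (\<Sum>b<r k. w (restrict i {1..k}) b * right_interface d U i k $$ (b, 0))"
      using p q W R w[OF p] right_interface_split_index[OF kd, of U n p q] i pr
      by (auto simp: scalar_prod_def atLeast0LessThan right_interface_mat_def intro!: sum.cong)
    also have "(?L * (mat_adjoint ?L * unfolding_mat d n k V)) $$ (p, q)
        = (\<Sum>b<r k. ?L $$ (p, b) * (mat_adjoint ?L * unfolding_mat d n k V) $$ (b, q))"
      using p q L K unfolding_mat_carrier[of d n k V]
      by (subst index_mult_mat(1)) (auto simp: scalar_prod_def atLeast0LessThan intro!: sum.cong simp del: assoc_mult_mat)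
    also have "\<dots> = (\<Sum>b<r k. core_prod U i k $$ (0, b) * left_coefficient n U k V b i)"
      by (intro sum.cong refl)
        (use p q i left_coefficient_unfolding[OF kd _ q, of _ r U V p] core_prod_split_index[OF kd, of U n p q]
          in \<open>simp add: left_interface_mat_def\<close>)
    finally show "V i = (\<Sum>b<r k. core_prod U i k $$ (0, b) * left_coefficient n U k V b i)
        + (\<Sum>b<r k. w (restrict i {1..k}) b * right_interface d U i k $$ (b, 0))" .
  next
    fix b b' assume b: "b < r k" "b' < r k"
    have "(\<Sum>p\<in>indices k n. cnj (w p b) * core_prod U p k $$ (0, b'))
        = (\<Sum>p<?N. cnj (w (prefix_index n k p) b) * core_prod U (prefix_index n k p) k $$ (0, b'))"
      by (rule sum_prefix_index[symmetric])
    also have "\<dots> = cnj (\<Sum>p<?N. mat_adjoint ?L $$ (b', p) * W $$ (p, b))"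
      using b w by (auto simp: mat_adjoint_entry left_interface_mat_def intro!: sum.cong)
    also have "(\<Sum>p<?N. mat_adjoint ?L $$ (b', p) * W $$ (p, b)) = (mat_adjoint ?L * W) $$ (b', b)"
      using b L W by (auto simp: scalar_prod_def atLeast0LessThan intro!: sum.cong)
    finally show "(\<Sum>p\<in>indices k n. cnj (w p b) * core_prod U p k $$ (0, b')) = 0" using KW b by simp
  qed
qed

text \<open>
  For \<open>w\<close> a matrix with rows numbered by the first \<open>k + 1\<close> entries, this is the core whose left unfolding is
  \<open>((L k)\<^sup>* \<otimes> 1) w\<close>, i.e. the coordinates of the projection of \<open>w\<close> onto the column span of
  \<open>L k \<otimes> 1\<close>.
\<close>
definition projected_core ::
  "(nat \<Rightarrow> nat) \<Rightarrow> (nat \<Rightarrow> nat) \<Rightarrow> (nat \<Rightarrow> core) \<Rightarrow> nat \<Rightarrow> ((nat \<Rightarrow> nat) \<Rightarrow> nat \<Rightarrow> complex) \<Rightarrow> core" where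
  "projected_core n r U k w x = mat (r k) (r (Suc k))
     (\<lambda>(a, b). \<Sum>p\<in>indices k n. cnj (core_prod U p k $$ (0, a)) * w (p(Suc k := x)) b)"

text \<open>
  \<open>L (k+1)\<close> is \<open>L k \<otimes> 1\<close> times the left unfolding of \<open>U (k+1)\<close>. Hence the adjoint of \<open>((L k)\<^sup>* \<otimes> 1) w\<close>
  times that left unfolding is \<open>w\<^sup>* L (k+1)\<close>.
\<close>
lemma projected_core_gauge:
  assumes U: "are_cores d n r U" and r: "r 0 = 1" and rk: "r k > 0" and k: "k < d"
    and w: "\<And>b b'. b < r (Suc k) \<Longrightarrow> b' < r (Suc k) \<Longrightarrow>
      (\<Sum>p\<in>indices (Suc k) n. cnj (w p b) * core_prod U p (Suc k) $$ (0, b')) = 0"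
  shows "mat_adjoint (left_unfolding (r k) (n (Suc k)) (r (Suc k)) (projected_core n r U k w))
    * left_unfolding (r k) (n (Suc k)) (r (Suc k)) (U (Suc k)) = 0\<^sub>m (r (Suc k)) (r (Suc k))"
    (is "?G = _")
proof (rule eq_matI)
  fix b b' assume "b < dim_row (0\<^sub>m (r (Suc k)) (r (Suc k)) :: complex mat)"
    "b' < dim_col (0\<^sub>m (r (Suc k)) (r (Suc k)) :: complex mat)"
  then have b: "b < r (Suc k)" "b' < r (Suc k)" by auto
  let ?w = "\<lambda>p x. cnj (w (p(Suc k := x)) b)"
  have "?G $$ (b, b') = (\<Sum>x<n (Suc k). \<Sum>a<r k.
      cnj (\<Sum>p\<in>indices k n. cnj (core_prod U p k $$ (0, a)) * w (p(Suc k := x)) b) * U (Suc k) x $$ (a, b'))"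
    using b by (subst left_unfolding_gram[OF rk b]) (simp add: projected_core_def)
  also have "\<dots> = (\<Sum>x<n (Suc k). \<Sum>a<r k. \<Sum>p\<in>indices k n.
      ?w p x * (core_prod U p k $$ (0, a) * U (Suc k) x $$ (a, b')))"
    unfolding cnj_sum sum_distrib_right by (intro sum.cong refl) (simp add: ac_simps)
  also have "\<dots> = (\<Sum>x<n (Suc k). \<Sum>p\<in>indices k n. \<Sum>a<r k.
      ?w p x * (core_prod U p k $$ (0, a) * U (Suc k) x $$ (a, b')))"
    by (intro sum.cong refl sum.swap)
  also have "\<dots> = (\<Sum>p\<in>indices k n. \<Sum>x<n (Suc k). \<Sum>a<r k.
      ?w p x * (core_prod U p k $$ (0, a) * U (Suc k) x $$ (a, b')))"
    by (rule sum.swap)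
  also have "\<dots> = (\<Sum>p\<in>indices k n. \<Sum>x<n (Suc k). ?w p x * core_prod U (p(Suc k := x)) (Suc k) $$ (0, b'))"
    by (intro sum.cong refl)
      (simp only: core_prod_Suc_entry[OF U r k _ _ b(2)] lessThan_iff sum_distrib_left)
  also have "\<dots> = (\<Sum>p\<in>indices (Suc k) n. cnj (w p b) * core_prod U p (Suc k) $$ (0, b'))"
    by (rule sum_indices_Suc[symmetric])
  also have "\<dots> = 0" by (rule w[OF b])
  finally show "?G $$ (b, b') = 0\<^sub>m (r (Suc k)) (r (Suc k)) $$ (b, b')" using b by simp
qed (simp_all add: left_unfolding_def)

text \<open>
  Apply \<open>(L k)\<^sup>*\<close> to the decomposition of \<open>V\<close> at \<open>k + 1\<close>. In the first summand,
  \<open>L (k+1)\<close> contains \<open>L k\<close> as a factor, which cancels by orthonormality and leaves the slice of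
  \<open>U (k+1)\<close>; the second one contains the projected core by definition. Multiplied by \<open>L k\<close>,
  this is the telescoping step.
\<close>
lemma left_coefficient_step:
  assumes U: "are_cores d n r U" and lo: "left_orthogonal d n r U" and r: "r 0 = 1"
    and rpos: "\<forall>k\<le>d. r k > 0" and k: "Suc k < d" and i: "i \<in> indices d n" and a: "a < r k"
    and V: "\<And>i. i \<in> indices d n \<Longrightarrow> V i =
      (\<Sum>b<r (Suc k). core_prod U i (Suc k) $$ (0, b) * left_coefficient n U (Suc k) V b i)
      + (\<Sum>b<r (Suc k). w (restrict i {1..Suc k}) b * right_interface d U i (Suc k) $$ (b, 0))"
  shows "left_coefficient n U k V a i =
    (\<Sum>b<r (Suc k). U (Suc k) (i (Suc k)) $$ (a, b) * left_coefficient n U (Suc k) V b i)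
    + (\<Sum>b<r (Suc k). projected_core n r U k w (i (Suc k)) $$ (a, b) * right_interface d U i (Suc k) $$ (b, 0))"
proof -
  define C where "C b = left_coefficient n U (Suc k) V b i" for b
  define h where "h b = right_interface d U i (Suc k) $$ (b, 0)" for b
  define l where "l p a = core_prod U p k $$ (0, a)" for p a
  define x where "x = i (Suc k)"
  have x: "x < n (Suc k)" using indices_less[OF i, of "Suc k"] k by (simp add: x_def)
  have Vs: "V (splice k p i) = (\<Sum>b<r (Suc k). \<Sum>a'<r k. l p a' * U (Suc k) x $$ (a', b) * C b)
      + (\<Sum>b<r (Suc k). w (p(Suc k := x)) b * h b)" if p: "p \<in> indices k n" for p
  proof -
    have s: "splice k p i \<in> indices d n" using splice_indices[OF _ p i] k by simp
    have c: "left_coefficient n U (Suc k) V b (splice k p i) = C b" for b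
    proof -
      have "splice (Suc k) p' (splice k p i) = splice (Suc k) p' i" for p'
        by (auto simp: splice_def)
      then show ?thesis by (simp add: C_def left_coefficient_def)
    qed
    have "core_prod U (splice k p i) (Suc k) = core_prod U (p(Suc k := x)) (Suc k)"
      by (rule core_prod_cong) (auto simp: splice_def x_def)
    then have e: "core_prod U (splice k p i) (Suc k) $$ (0, b) = (\<Sum>a'<r k. l p a' * U (Suc k) x $$ (a', b))"
      if "b < r (Suc k)" for b
      using core_prod_Suc_entry[OF U r _ p x that] k by (simp add: l_def)
    have h: "right_interface d U (splice k p i) (Suc k) $$ (b, 0) = h b" for b
      unfolding h_def using k by (intro arg_cong2[of _ _ _ _ "($$)"] right_interface_cong) (auto simp: splice_def)
    show ?thesis unfolding V[OF s] c h splice_restrict[OF p] x_def[symmetric]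
      by (intro arg_cong2[of _ _ _ _ "(+)"] sum.cong refl) (simp add: e sum_distrib_right del: core_prod.simps)
  qed
  have "left_coefficient n U k V a i = (\<Sum>p\<in>indices k n. cnj (l p a) * V (splice k p i))"
    by (simp add: left_coefficient_def l_def)
  also have "\<dots> = (\<Sum>p\<in>indices k n. (\<Sum>b<r (Suc k). \<Sum>a'<r k. U (Suc k) x $$ (a', b) * C b * (cnj (l p a) * l p a'))
      + (\<Sum>b<r (Suc k). cnj (l p a) * w (p(Suc k := x)) b * h b))"
    by (intro sum.cong refl) (simp add: Vs sum_distrib_left distrib_left ac_simps)
  also have "\<dots> = (\<Sum>p\<in>indices k n. \<Sum>b<r (Suc k). \<Sum>a'<r k. U (Suc k) x $$ (a', b) * C b * (cnj (l p a) * l p a'))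
      + (\<Sum>p\<in>indices k n. \<Sum>b<r (Suc k). cnj (l p a) * w (p(Suc k := x)) b * h b)"
    by (rule sum.distrib)
  also have "(\<Sum>p\<in>indices k n. \<Sum>b<r (Suc k). cnj (l p a) * w (p(Suc k := x)) b * h b)
      = (\<Sum>b<r (Suc k). (\<Sum>p\<in>indices k n. cnj (l p a) * w (p(Suc k := x)) b) * h b)"
    by (subst sum.swap) (simp add: sum_distrib_right)
  also have "\<dots> = (\<Sum>b<r (Suc k). projected_core n r U k w x $$ (a, b) * h b)"
    using a by (simp add: projected_core_def l_def)
  also have "(\<Sum>p\<in>indices k n. \<Sum>b<r (Suc k). \<Sum>a'<r k. U (Suc k) x $$ (a', b) * C b * (cnj (l p a) * l p a'))
      = (\<Sum>b<r (Suc k). \<Sum>a'<r k. \<Sum>p\<in>indices k n. U (Suc k) x $$ (a', b) * C b * (cnj (l p a) * l p a'))"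
    by (rule trans[OF sum.swap], rule sum.cong[OF refl], rule sum.swap)
  also have "\<dots> = (\<Sum>b<r (Suc k). \<Sum>a'<r k. U (Suc k) x $$ (a', b) * C b * prefix_gram n U U k a a')"
    by (simp add: prefix_gram_def l_def sum_distrib_left)
  also have "\<dots> = (\<Sum>b<r (Suc k). \<Sum>a'<r k. U (Suc k) x $$ (a', b) * C b * (if a = a' then 1 else 0))"
    using prefix_gram_orthonormal[OF U lo r rpos _ a] k by (intro sum.cong refl) simp
  also have "\<dots> = (\<Sum>b<r (Suc k). U (Suc k) x $$ (a, b) * C b)"
    using a by (simp add: if_distrib cong: if_cong)
  finally show ?thesis by (simp add: C_def h_def x_def)
qed

text \<open>
  Telescoping \<open>left_coefficient_step\<close> from 0 to \<open>d - 1\<close>. The remainder \<open>L (d-1) * C (d-1)\<close> is the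
  last term of the tangent form, because \<open>C (d-1)\<close> depends on the last entry only and is thus a core.
\<close>
lemma tt_tangent_subset:
  assumes U: "are_cores d n r U" and lo: "left_orthogonal d n r U" and r: "r 0 = 1" "r d = 1"
    and rpos: "\<forall>k\<le>d. r k > 0" and d: "d > 0" and X: "tt d n U \<in> tt_manifold d n r"
    and V: "V \<in> tangent_space (tt_manifold d n r) (tt d n U)" and Vt: "V \<in> tensors d n"
  obtains D where "are_cores d n r D"
    "\<forall>k\<in>{1..d-1}. mat_adjoint (left_unfolding (r (k - 1)) (n k) (r k) (D k))
            * left_unfolding (r (k - 1)) (n k) (r k) (U k) = 0\<^sub>m (r k) (r k)"
    "V = (\<lambda>i. \<Sum>k=1..d. tt d n (U(k := D k)) i)"
proof -
  define dec where "dec k w \<longleftrightarrow> (\<forall>i\<in>indices d n. V i =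
      (\<Sum>b<r k. core_prod U i k $$ (0, b) * left_coefficient n U k V b i)
      + (\<Sum>b<r k. w (restrict i {1..k}) b * right_interface d U i k $$ (b, 0)))" for k w
  define orth where "orth k w \<longleftrightarrow> (\<forall>b<r k. \<forall>b'<r k.
      (\<Sum>p\<in>indices k n. cnj (w p b) * core_prod U p k $$ (0, b')) = 0)" for k w
  have "\<forall>k. \<exists>w. 0 < k \<and> k < d \<longrightarrow> dec k w \<and> orth k w"
  proof
    fix k
    show "\<exists>w. 0 < k \<and> k < d \<longrightarrow> dec k w \<and> orth k w"
    proof (cases "0 < k \<and> k < d")
      case True
      then have k: "0 < k" "k < d" by auto
      show ?thesis
      proof (rule tangent_unfolding_split[OF U lo r rpos X V k])
        fix w :: "(nat \<Rightarrow> nat) \<Rightarrow> nat \<Rightarrow> complex"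
        assume "\<And>i. i \<in> indices d n \<Longrightarrow> V i =
          (\<Sum>b<r k. core_prod U i k $$ (0, b) * left_coefficient n U k V b i)
          + (\<Sum>b<r k. w (restrict i {1..k}) b * right_interface d U i k $$ (b, 0))"
          and "\<And>b b'. b < r k \<Longrightarrow> b' < r k \<Longrightarrow> (\<Sum>p\<in>indices k n. cnj (w p b) * core_prod U p k $$ (0, b')) = 0"
        then have "dec k w \<and> orth k w" unfolding dec_def orth_def by blast
        then show ?thesis by blast
      qed
    qed auto
  qed
  from choice[OF this] obtain w where ch: "\<And>k. 0 < k \<and> k < d \<Longrightarrow> dec k (w k) \<and> orth k (w k)" by blast
  have w: "V i = (\<Sum>b<r k. core_prod U i k $$ (0, b) * left_coefficient n U k V b i)
        + (\<Sum>b<r k. w k (restrict i {1..k}) b * right_interface d U i k $$ (b, 0))"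
    if "0 < k" "k < d" "i \<in> indices d n" for k i
    using ch[of k] that by (simp add: dec_def)
  have wo: "(\<Sum>p\<in>indices k n. cnj (w k p b) * core_prod U p k $$ (0, b')) = 0"
    if "0 < k" "k < d" "b < r k" "b' < r k" for k b b'
    using ch[of k] that by (simp add: orth_def)
  \<comment> \<open>For \<open>k = d\<close> the tensor \<open>V\<close> itself replaces \<open>w\<close>, which produces \<open>(L (d-1))\<^sup>* V\<close>.\<close>
  define D where "D k = projected_core n r U (k - 1) (if k = d then (\<lambda>p b. V p) else w k)" for k
  have D: "are_cores d n r D"
    by (auto simp: are_cores_def is_core_def D_def projected_core_def)
  have gauge: "mat_adjoint (left_unfolding (r (k - 1)) (n k) (r k) (D k))
            * left_unfolding (r (k - 1)) (n k) (r k) (U k) = 0\<^sub>m (r k) (r k)" if kd: "k \<in> {1..d-1}" for k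
  proof -
    obtain k' where k': "k = Suc k'" "Suc k' < d" using kd by (cases k) auto
    show ?thesis using projected_core_gauge[OF U r(1), of k' "w (Suc k')"] rpos wo[of "Suc k'"] k'
      by (simp add: D_def)
  qed
  have part: "V i = (\<Sum>k=1..K. tt d n (U(k := D k)) i) + (\<Sum>a<r K. core_prod U i K $$ (0, a) * left_coefficient n U K V a i)"
    if "K < d" and i: "i \<in> indices d n" for i K
    using that(1)
  proof (induction K)
    case 0
    have "splice 0 p i = i" for p by (auto simp: splice_def)
    then show ?case by (simp add: r left_coefficient_def indices_def)
  next
    case (Suc K)
    have K: "K < d" using Suc by simp
    let ?x = "i (Suc K)" let ?h = "right_interface d U i (Suc K)" let ?C = "\<lambda>b. left_coefficient n U (Suc K) V b i"
    have cs: "left_coefficient n U K V a i = (\<Sum>b<r (Suc K). U (Suc K) ?x $$ (a, b) * ?C b)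
      + (\<Sum>b<r (Suc K). D (Suc K) ?x $$ (a, b) * ?h $$ (b, 0))" if "a < r K" for a
      using left_coefficient_step[OF U lo r(1) rpos Suc.prems i that w[of "Suc K"]] Suc.prems by (simp add: D_def)
    have "(\<Sum>a<r K. core_prod U i K $$ (0, a) * left_coefficient n U K V a i)
      = (\<Sum>a<r K. \<Sum>b<r (Suc K). core_prod U i K $$ (0, a) * U (Suc K) ?x $$ (a, b) * ?C b)
       + (\<Sum>a<r K. \<Sum>b<r (Suc K). core_prod U i K $$ (0, a) * D (Suc K) ?x $$ (a, b) * ?h $$ (b, 0))"
      unfolding sum.distrib[symmetric]
      by (intro sum.cong refl) (simp add: cs distrib_left sum_distrib_left mult.assoc sum.distrib)
    also have "(\<Sum>a<r K. \<Sum>b<r (Suc K). core_prod U i K $$ (0, a) * D (Suc K) ?x $$ (a, b) * ?h $$ (b, 0))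
      = tt d n (U(Suc K := D (Suc K))) i" by (rule tt_upd_entry[OF U D r i K, symmetric])
    also have "(\<Sum>a<r K. \<Sum>b<r (Suc K). core_prod U i K $$ (0, a) * U (Suc K) ?x $$ (a, b) * ?C b)
      = (\<Sum>b<r (Suc K). (\<Sum>a<r K. core_prod U i K $$ (0, a) * U (Suc K) ?x $$ (a, b)) * ?C b)"
      by (subst sum.swap) (simp add: sum_distrib_right)
    also have "\<dots> = (\<Sum>b<r (Suc K). core_prod U i (Suc K) $$ (0, b) * ?C b)"
      by (intro sum.cong refl arg_cong2[of _ _ _ _ "(*)"])
        (use core_prod_carrier_full[OF U r(1) _ i, of K] core_carrier[OF U K, of i] indices_less[OF i, of "Suc K"] K
          in \<open>auto simp: scalar_prod_def atLeast0LessThan\<close>)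
    finally show ?case using Suc.IH[OF K] by simp
  qed
  obtain K where K: "d = Suc K" using d by (cases d) auto
  have "V i = (\<Sum>k=1..d. tt d n (U(k := D k)) i)" for i
  proof (cases "i \<in> indices d n")
    case True
    have "left_coefficient n U K V a i = D d (i d) $$ (a, 0)" if "a < r K" for a
    proof -
      have "splice K p i = p(d := i d)" if p: "p \<in> indices K n" for p
        using True p K by (auto simp: splice_def indices_def PiE_iff extensional_def fun_eq_iff le_Suc_eq)
      then show ?thesis using that r K by (simp add: left_coefficient_def D_def projected_core_def)
    qed
    then have "(\<Sum>a<r K. core_prod U i K $$ (0, a) * left_coefficient n U K V a i) = tt d n (U(d := D d)) i"
      using tt_upd_entry[OF U D r True, of K] K r by simp
    then show ?thesis using part[OF _ True, of K] K by simp
  next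
    case False
    then show ?thesis using Vt by (simp add: tt_def tensors_def)
  qed
  then show ?thesis using that[OF D] gauge by blast
qed

section \<open>Tensors of the tangent form are velocities\<close>

definition core_line :: "(nat \<Rightarrow> core) \<Rightarrow> (nat \<Rightarrow> core) \<Rightarrow> real \<Rightarrow> nat \<Rightarrow> core" where
  "core_line U D t k x = U k x + complex_of_real t \<cdot>\<^sub>m D k x"

lemma core_line_cores: "are_cores d n r U \<Longrightarrow> are_cores d n r D \<Longrightarrow> are_cores d n r (core_line U D t)"
  by (auto simp: are_cores_def is_core_def core_line_def)

lemma core_line_entry:
  assumes "are_cores d n r U" "are_cores d n r D" "k < d" "x < n (Suc k)" "a < r k" "b < r (Suc k)"
  shows "core_line U D t (Suc k) x $$ (a, b) = U (Suc k) x $$ (a, b) + complex_of_real t * D (Suc k) x $$ (a, b)"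
  using core_carrier[OF assms(1,3), of "\<lambda>_. x"] core_carrier[OF assms(2,3), of "\<lambda>_. x"] assms(4-)
  by (simp add: core_line_def)

text \<open>
  Stated for arbitrary families of cores rather than lines, because the derivative of the curve along a line of cores
  involves that line with one core replaced.
\<close>
lemma core_prod_continuous:
  fixes W :: "real \<Rightarrow> nat \<Rightarrow> core"
  assumes W: "\<And>t. are_cores d n r (W t)" and r: "r 0 = 1" and i: "i \<in> indices d n"
    and cont: "\<And>k x a b. k < d \<Longrightarrow> x < n (Suc k) \<Longrightarrow> a < r k \<Longrightarrow> b < r (Suc k) \<Longrightarrow>
      continuous_on T (\<lambda>t. W t (Suc k) x $$ (a, b))"
    and k: "k \<le> d" and b: "b < r k"
  shows "continuous_on T (\<lambda>t. core_prod (W t) i k $$ (0, b))"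
  using k b
proof (induction k arbitrary: b)
  case (Suc k)
  then have k: "k < d" by simp
  show ?case unfolding core_prod_Suc_entry_full[OF W r k i Suc.prems(2)]
    using Suc k indices_less[OF i, of "Suc k"] by (intro continuous_intros cont) auto
qed simp

text \<open>
  The product rule, one core at a time.
\<close>
lemma core_prod_line_derivative:
  assumes U: "are_cores d n r U" and D: "are_cores d n r D" and r: "r 0 = 1" and i: "i \<in> indices d n"
    and k: "k \<le> d" and b: "b < r k"
  shows "((\<lambda>t. core_prod (core_line U D t) i k $$ (0, b)) has_vector_derivative
    (\<Sum>j=1..k. core_prod ((core_line U D t)(j := D j)) i k $$ (0, b))) (at t)"
  using k b
proof (induction k arbitrary: b)
  case (Suc k)
  let ?W = "core_line U D" and ?x = "i (Suc k)"
  have k: "k < d" using Suc.prems by simp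
  have x: "?x < n (Suc k)" using indices_less[OF i, of "Suc k"] k by simp
  note W = core_line_cores[OF U D]
  note WD = are_cores_upd[OF W D]
  have line: "((\<lambda>t. ?W t (Suc k) ?x $$ (a, b)) has_vector_derivative D (Suc k) ?x $$ (a, b)) (at t)" if a: "a < r k" for a
    unfolding core_line_entry[OF U D k x a Suc.prems(2)]
    by (auto intro!: derivative_eq_intros)
  have "(\<Sum>j=1..Suc k. core_prod ((?W t)(j := D j)) i (Suc k) $$ (0, b))
      = (\<Sum>j=1..k. \<Sum>a<r k. core_prod ((?W t)(j := D j)) i k $$ (0, a) * ?W t (Suc k) ?x $$ (a, b))
      + (\<Sum>a<r k. core_prod (?W t) i k $$ (0, a) * D (Suc k) ?x $$ (a, b))"
  proof -
    have "core_prod ((?W t)(Suc k := D (Suc k))) i k = core_prod (?W t) i k"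
      by (rule core_prod_cong) auto
    moreover have "(\<Sum>j=1..k. core_prod ((?W t)(j := D j)) i (Suc k) $$ (0, b))
        = (\<Sum>j=1..k. \<Sum>a<r k. core_prod ((?W t)(j := D j)) i k $$ (0, a) * ?W t (Suc k) ?x $$ (a, b))"
    proof (rule sum.cong[OF refl])
      fix j assume "j \<in> {1..k}"
      then show "core_prod ((?W t)(j := D j)) i (Suc k) $$ (0, b)
          = (\<Sum>a<r k. core_prod ((?W t)(j := D j)) i k $$ (0, a) * ?W t (Suc k) ?x $$ (a, b))"
        unfolding core_prod_Suc_entry_full[OF WD r k i Suc.prems(2)] by simp
    qed
    ultimately show ?thesis
      using core_prod_Suc_entry_full[OF WD r k i Suc.prems(2), of t "Suc k"] by (simp del: core_prod.simps)
  qed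
  also have "\<dots> = (\<Sum>a<r k. core_prod (?W t) i k $$ (0, a) * D (Suc k) ?x $$ (a, b)
      + (\<Sum>j=1..k. core_prod ((?W t)(j := D j)) i k $$ (0, a)) * ?W t (Suc k) ?x $$ (a, b))"
    by (subst sum.swap) (simp add: sum.distrib sum_distrib_right add.commute)
  finally have e: "(\<Sum>j=1..Suc k. core_prod ((?W t)(j := D j)) i (Suc k) $$ (0, b)) = \<dots>" .
  show ?case unfolding e core_prod_Suc_entry_full[OF W r k i Suc.prems(2)]
    by (intro has_vector_derivative_sum has_vector_derivative_mult line Suc.IH) (use k in auto)
qed simp

text \<open>
  The curve \<open>t \<mapsto> tt d n (U + t \<cdot> D)\<close> has unfoldings that factor through \<open>r k\<close>, so their
  ranks are at most \<open>r k\<close> for all \<open>t\<close>; semicontinuity gives equality for small \<open>t\<close>.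
\<close>
lemma tt_tangent_superset:
  assumes U: "are_cores d n r U" and lo: "left_orthogonal d n r U" and r: "r 0 = 1" "r d = 1"
    and rpos: "\<forall>k\<le>d. r k > 0" and X: "tt d n U \<in> tt_manifold d n r" and D: "are_cores d n r D"
  shows "(\<lambda>i. \<Sum>k=1..d. tt d n (U(k := D k)) i) \<in> tangent_space (tt_manifold d n r) (tt d n U)"
proof -
  let ?W = "core_line U D"
  note W = core_line_cores[OF U D]
  define \<gamma> where "\<gamma> t = tt d n (?W t)" for t
  define \<gamma>' where "\<gamma>' t i = (\<Sum>k=1..d. tt d n ((?W t)(k := D k)) i)" for t i
  have W0: "?W 0 k x = U k x" if "k \<in> {1..d}" "x < n k" for k x
  proof -
    have "U k x \<in> carrier_mat (r (k - 1)) (r k)" "D k x \<in> carrier_mat (r (k - 1)) (r k)"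
      using U D that by (auto simp: are_cores_def is_core_def)
    then show ?thesis unfolding core_line_def by (intro eq_matI) auto
  qed
  have g0: "\<gamma> 0 = tt d n U" unfolding \<gamma>_def by (rule tt_cong) (rule W0)
  have g'0: "\<gamma>' 0 = (\<lambda>i. \<Sum>k=1..d. tt d n (U(k := D k)) i)"
    unfolding \<gamma>'_def by (intro ext sum.cong refl fun_cong[OF tt_cong]) (simp add: W0)
  have deriv: "((\<lambda>s. \<gamma> s i) has_vector_derivative \<gamma>' t i) (at t)" for i t
    using core_prod_line_derivative[OF U D r(1), of i d 0] r by (cases "i \<in> indices d n") (simp_all add: \<gamma>_def \<gamma>'_def tt_def)
  have cont': "continuous_on T (\<lambda>t. \<gamma>' t i)" for T i
  proof (cases "i \<in> indices d n")
    case True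
    have "continuous_on T (\<lambda>t. core_prod ((?W t)(k := D k)) i d $$ (0, 0))" for k
    proof (rule core_prod_continuous[OF are_cores_upd[OF W D] r(1) True])
      fix j x a b assume j: "j < d" "x < n (Suc j)" "a < r j" "b < r (Suc j)"
      have "continuous_on T (\<lambda>t. core_line U D t (Suc j) x $$ (a, b))"
        unfolding core_line_entry[OF U D j] by (intro continuous_intros)
      then show "continuous_on T (\<lambda>t. ((?W t)(k := D k)) (Suc j) x $$ (a, b))" by (cases "Suc j = k") auto
    qed (use r in auto)
    then show ?thesis using True unfolding \<gamma>'_def tt_def by (auto intro!: continuous_intros)
  qed (simp add: \<gamma>'_def tt_def)
  have ev: "\<forall>\<^sub>F t in nhds 0. r k \<le> mat_rank (unfolding_mat d n k (\<gamma> t))" if k: "k \<in> {1..d-1}" for k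
  proof -
    have kd: "k < d" using k by auto
    let ?L = "left_interface_mat n r U k" and ?R = "right_interface_mat d n r U k"
    have L: "?L \<in> carrier_mat (\<Prod>l\<in>{1..k}. n l) (r k)" and R: "?R \<in> carrier_mat (r k) (\<Prod>l\<in>{k+1..d}. n l)"
      by (simp_all add: left_interface_mat_def right_interface_mat_def)
    have K: "mat_adjoint ?L \<in> carrier_mat (r k) (\<Prod>l\<in>{1..k}. n l)" using L by auto
    have f: "unfolding_mat d n k (\<gamma> 0) = ?L * ?R" using unfolding_tt[OF U r] kd g0 by simp
    have KL: "mat_adjoint ?L * ?L = 1\<^sub>m (r k)" using left_interface_gram[OF U lo r(1) rpos kd] .
    have "mat_rank (?L * ?R) = r k"
      using X kd k f g0 unfolding tt_manifold_def tt_rank_def by (auto dest: spec[of _ k])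
    then obtain S where S: "S \<in> carrier_mat (\<Prod>l\<in>{k+1..d}. n l) (r k)" "?R * S = 1\<^sub>m (r k)"
      using factor_right_inverse[OF L R] by blast
    show ?thesis
    proof (rule mat_rank_lower_semicontinuous[OF unfolding_mat_carrier _ K S(1)])
      show "isCont (\<lambda>t. unfolding_mat d n k (\<gamma> t) $$ (p, q)) 0"
        if "p < (\<Prod>l\<in>{1..k}. n l)" "q < (\<Prod>l\<in>{k+1..d}. n l)" for p q
        using has_vector_derivative_continuous[OF deriv] that by (simp add: unfolding_mat_def)
      have "mat_adjoint ?L * (?L * ?R) = ?R" using KL R by (simp flip: assoc_mult_mat[OF K L R])
      then show "mat_adjoint ?L * unfolding_mat d n k (\<gamma> 0) * S = 1\<^sub>m (r k)" using f S(2) by simp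
    qed
  qed
  then have "\<forall>\<^sub>F t in nhds 0. \<forall>k\<in>{1..d-1}. r k \<le> mat_rank (unfolding_mat d n k (\<gamma> t))"
    by (intro eventually_ball_finite) auto
  \<comment> \<open>Only the finitely many \<open>k\<close> strictly between 0 and \<open>d\<close> constrain \<open>\<epsilon>\<close>.\<close>
  then obtain \<epsilon> where eps: "\<epsilon> > 0"
    and ge: "\<And>t k. dist t 0 < \<epsilon> \<Longrightarrow> k \<in> {1..d-1} \<Longrightarrow> r k \<le> mat_rank (unfolding_mat d n k (\<gamma> t))"
    unfolding eventually_nhds_metric by blast
  have "\<gamma> t \<in> tt_manifold d n r" if t: "t \<in> {-\<epsilon><..<\<epsilon>}" for t
  proof -
    have "tt_rank d n (\<gamma> t) k = r k" if "k \<le> d" for k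
    proof (cases "k \<in> {1..d-1}")
      case True
      have "unfolding_mat d n k (\<gamma> t) = left_interface_mat n r (?W t) k * right_interface_mat d n r (?W t) k"
        using unfolding_tt[OF W r \<open>k \<le> d\<close>] by (simp add: \<gamma>_def)
      then have "mat_rank (unfolding_mat d n k (\<gamma> t)) \<le> r k"
        using mat_rank_mult_le[of "left_interface_mat n r (?W t) k" "\<Prod>l\<in>{1..k}. n l" "r k"
            "right_interface_mat d n r (?W t) k" "\<Prod>l\<in>{k+1..d}. n l"]
        by (simp add: left_interface_mat_def right_interface_mat_def)
      moreover have "r k \<le> mat_rank (unfolding_mat d n k (\<gamma> t))"
        by (rule ge[OF _ True]) (use t in \<open>auto simp: dist_real_def abs_less_iff\<close>)
      ultimately show ?thesis using True by (auto simp: tt_rank_def)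
    next
      case False
      then have "k = 0 \<or> k = d" using that by auto
      then show ?thesis using r by (auto simp: tt_rank_def)
    qed
    then show ?thesis by (simp add: tt_manifold_def tensors_def \<gamma>_def tt_def)
  qed
  then show ?thesis unfolding tangent_space_def
    using eps g0 g'0 deriv cont' by blast
qed

section \<open>The tangent space of the normalized manifold\<close>

theorem proposition3p3:
  fixes d :: nat and n r :: "nat \<Rightarrow> nat" and U :: "nat \<Rightarrow> core" and X :: tensor
  assumes "d \<ge> 2"
    and "\<forall>k\<le>d. r k > 0" and "r 0 = 1" and "r d = 1"
    and "are_cores d n r U"
    and "left_orthogonal d n r U"
    and "X = tt d n U"
    and "X \<in> normalized_tt_manifold d n r"
  shows "normalized_tt_tangent d n r X =
    {(\<lambda>i. \<Sum>k=1..d. tt d n (U(k := dU k)) i) | dU :: nat \<Rightarrow> core.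
       are_cores d n r dU \<and>
       (\<forall>k\<in>{1..d-1}.
          mat_adjoint (left_unfolding (r (k - 1)) (n k) (r k) (dU k))
            * left_unfolding (r (k - 1)) (n k) (r k) (U k) = 0\<^sub>m (r k) (r k)) \<and>
       core_inner (r (d - 1)) (n d) (r d) (dU d) (U d) = 0}"
    (is "_ = ?T")
proof (intro subset_antisym subsetI)
  note U = assms(5) and lo = assms(6) and r = assms(3,4) and rpos = assms(2)
  have d: "d > 0" using assms(1) by simp
  have M: "tt d n U \<in> tt_manifold d n r" using assms(7,8) by (simp add: normalized_tt_manifold_def)
  {
    fix V assume "V \<in> normalized_tt_tangent d n r X"
    then have V: "V \<in> tangent_space (tt_manifold d n r) (tt d n U)" and Vt: "V \<in> tensors d n"
      and VX: "tensor_inner d n V (tt d n U) = 0"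
      using assms(7) by (simp_all add: normalized_tt_tangent_def sphere_tangent_def)
    obtain D where D: "are_cores d n r D"
      and gauge: "\<forall>k\<in>{1..d-1}. mat_adjoint (left_unfolding (r (k - 1)) (n k) (r k) (D k))
            * left_unfolding (r (k - 1)) (n k) (r k) (U k) = 0\<^sub>m (r k) (r k)"
      and VD: "V = (\<lambda>i. \<Sum>k=1..d. tt d n (U(k := D k)) i)"
      by (rule tt_tangent_subset[OF U lo r rpos d M V Vt])
    have "core_inner (r (d - 1)) (n d) (r d) (D d) (U d) = 0"
      using tensor_inner_tangent[OF U D lo r rpos d gauge] VX unfolding VD by (rule trans[OF sym])
    then show "V \<in> ?T" using D gauge VD by blast
  next
    fix V assume "V \<in> ?T"
    then obtain D where D: "are_cores d n r D"
      and gauge: "\<forall>k\<in>{1..d-1}. mat_adjoint (left_unfolding (r (k - 1)) (n k) (r k) (D k))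
            * left_unfolding (r (k - 1)) (n k) (r k) (U k) = 0\<^sub>m (r k) (r k)"
      and last: "core_inner (r (d - 1)) (n d) (r d) (D d) (U d) = 0"
      and VD: "V = (\<lambda>i. \<Sum>k=1..d. tt d n (U(k := D k)) i)" by blast
    have "V \<in> tangent_space (tt_manifold d n r) (tt d n U)"
      unfolding VD by (rule tt_tangent_superset[OF U lo r rpos M D])
    moreover have "tensor_inner d n V (tt d n U) = 0"
      unfolding VD tensor_inner_tangent[OF U D lo r rpos d gauge] by (rule last)
    moreover have "V \<in> tensors d n" unfolding VD by (simp add: tensors_def tt_def)
    ultimately show "V \<in> normalized_tt_tangent d n r X"
      using assms(7) by (simp add: normalized_tt_tangent_def sphere_tangent_def)
  }
qed

end
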